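(* Let $A$ be a compact C*-algebra and $M\subseteq N$ Hilbert $A$-modules with $M^\perp_N=\{0\}$. Then $M=N$; consequently the only bounded $A$-linear map $N\to A$ vanishing on $M$ is the zero map. Moreover, for every Hilbert $A$-module $N$ and every bounded $A$-linear operator $T$ from $N$ to another Hilbert $A$-module, $\ker(T)=\ker(T)^{\perp\perp}$ in $N$.
   Context: A C*-algebra is compact if it admits a faithful $*$-representation in the C*-algebra of compact operators on some Hilbert space. Hilbert $A$-modules are right modules with an $A$-valued inner product, $A$-linear in the second variable, positive definite, complete in $\|x\|=\|\langle x,x\rangle\|^{1/2}$. $M^\perp_N=\{y\in N:\langle x,y\rangle=0\ \forall x\in M\}$, $S^{\perp\perp}=(S^\perp)^\perp$. *)

theory Defs
  imports Complex_Main
begin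

definition nf_cauchy :: "('v::ab_group_add \<Rightarrow> real) \<Rightarrow> (nat \<Rightarrow> 'v) \<Rightarrow> bool" where
  "nf_cauchy nf X \<longleftrightarrow> (\<forall>e>0. \<exists>K. \<forall>m\<ge>K. \<forall>n\<ge>K. nf (X m - X n) < e)"

definition nf_lim :: "('v::ab_group_add \<Rightarrow> real) \<Rightarrow> (nat \<Rightarrow> 'v) \<Rightarrow> 'v \<Rightarrow> bool" where
  "nf_lim nf X l \<longleftrightarrow> (\<forall>e>0. \<exists>K. \<forall>n\<ge>K. nf (X n - l) < e)"

definition nf_complete :: "('v::ab_group_add \<Rightarrow> real) \<Rightarrow> 'v set \<Rightarrow> bool" where
  "nf_complete nf S \<longleftrightarrow>
     (\<forall>X. (\<forall>n. X n \<in> S) \<and> nf_cauchy nf X \<longrightarrow> (\<exists>l\<in>S. nf_lim nf X l))"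

definition nf_closed :: "('v::ab_group_add \<Rightarrow> real) \<Rightarrow> 'v set \<Rightarrow> bool" where
  "nf_closed nf S \<longleftrightarrow> (\<forall>X l. (\<forall>n. X n \<in> S) \<and> nf_lim nf X l \<longrightarrow> l \<in> S)"

definition cstar_algebra ::
  "(complex \<Rightarrow> 'a::{real_normed_algebra,banach} \<Rightarrow> 'a) \<Rightarrow> ('a \<Rightarrow> 'a) \<Rightarrow> bool" where
  "cstar_algebra sc st \<longleftrightarrow>
     vector_space sc \<and>
     (\<forall>r x. sc (complex_of_real r) x = r *\<^sub>R x) \<and>
     (\<forall>c x. norm (sc c x) = cmod c * norm x) \<and>
     (\<forall>c x y. sc c (x * y) = sc c x * y \<and> sc c (x * y) = x * sc c y) \<and>
     (\<forall>x y. st (x + y) = st x + st y) \<and>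
     (\<forall>c x. st (sc c x) = sc (cnj c) (st x)) \<and>
     (\<forall>x y. st (x * y) = st y * st x) \<and>
     (\<forall>x. st (st x) = x) \<and>
     (\<forall>x. norm (st x * x) = (norm x)\<^sup>2)"

definition hnorm :: "('h \<Rightarrow> 'h \<Rightarrow> complex) \<Rightarrow> 'h \<Rightarrow> real" where
  "hnorm ip x = sqrt (Re (ip x x))"

definition hilbert_space :: "(complex \<Rightarrow> 'h::ab_group_add \<Rightarrow> 'h) \<Rightarrow> ('h \<Rightarrow> 'h \<Rightarrow> complex) \<Rightarrow> bool" where
  "hilbert_space sc ip \<longleftrightarrow>
     vector_space sc \<and>
     (\<forall>x y z. ip x (y + z) = ip x y + ip x z) \<and>
     (\<forall>c x y. ip x (sc c y) = c * ip x y) \<and>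
     (\<forall>x y. ip y x = cnj (ip x y)) \<and>
     (\<forall>x. ip x x \<in> \<real> \<and> 0 \<le> Re (ip x x)) \<and>
     (\<forall>x. ip x x = 0 \<longrightarrow> x = 0) \<and>
     nf_complete (hnorm ip) UNIV"

definition compact_op :: "(complex \<Rightarrow> 'h::ab_group_add \<Rightarrow> 'h) \<Rightarrow> ('h \<Rightarrow> 'h \<Rightarrow> complex) \<Rightarrow> ('h \<Rightarrow> 'h) \<Rightarrow> bool" where
  "compact_op sc ip T \<longleftrightarrow>
     (\<forall>x y. T (x + y) = T x + T y) \<and> (\<forall>c x. T (sc c x) = sc c (T x)) \<and>
     (\<forall>X :: nat \<Rightarrow> 'h. (\<forall>n. hnorm ip (X n) \<le> 1) \<longrightarrow>
        (\<exists>r. strict_mono r \<and> (\<exists>l. nf_lim (hnorm ip) (\<lambda>n. T (X (r n))) l)))"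

text \<open>A C*-algebra is compact if it admits a faithful *-representation by compact
  operators on some Hilbert space. The Hilbert space lives on the type given by the
  first (itself) argument; in the theorem this type is a free (hence arbitrary) type
  variable.\<close>
definition compact_cstar ::
  "'h::ab_group_add itself \<Rightarrow> (complex \<Rightarrow> 'a::{real_normed_algebra,banach} \<Rightarrow> 'a) \<Rightarrow> ('a \<Rightarrow> 'a) \<Rightarrow> bool" where
  "compact_cstar t sc st \<longleftrightarrow>
     (\<exists>(hsc :: complex \<Rightarrow> 'h \<Rightarrow> 'h) ip (\<pi> :: 'a \<Rightarrow> 'h \<Rightarrow> 'h).
        hilbert_space hsc ip \<and>
        inj \<pi> \<and>
        (\<forall>a. compact_op hsc ip (\<pi> a)) \<and>
        (\<forall>a b u. \<pi> (a + b) u = \<pi> a u + \<pi> b u) \<and>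
        (\<forall>c a u. \<pi> (sc c a) u = hsc c (\<pi> a u)) \<and>
        (\<forall>a b u. \<pi> (a * b) u = \<pi> a (\<pi> b u)) \<and>
        (\<forall>a u v. ip (\<pi> (st a) u) v = ip u (\<pi> a v)))"

definition hm_norm :: "('n \<Rightarrow> 'n \<Rightarrow> 'a::real_normed_vector) \<Rightarrow> 'n \<Rightarrow> real" where
  "hm_norm inn x = sqrt (norm (inn x x))"

text \<open>Positivity in the C*-algebra is expressed as being of the form b* b.\<close>
definition hilbert_module ::
  "(complex \<Rightarrow> 'a::{real_normed_algebra,banach} \<Rightarrow> 'a) \<Rightarrow> ('a \<Rightarrow> 'a) \<Rightarrow>
   (complex \<Rightarrow> 'n::ab_group_add \<Rightarrow> 'n) \<Rightarrow> ('n \<Rightarrow> 'a \<Rightarrow> 'n) \<Rightarrow> ('n \<Rightarrow> 'n \<Rightarrow> 'a) \<Rightarrow> bool" where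
  "hilbert_module scA st sc act inn \<longleftrightarrow>
     vector_space sc \<and>
     (\<forall>x y a. act (x + y) a = act x a + act y a) \<and>
     (\<forall>x a b. act x (a + b) = act x a + act x b) \<and>
     (\<forall>x a b. act x (a * b) = act (act x a) b) \<and>
     (\<forall>c x a. sc c (act x a) = act (sc c x) a \<and> sc c (act x a) = act x (scA c a)) \<and>
     (\<forall>x y z. inn x (y + z) = inn x y + inn x z) \<and>
     (\<forall>c x y. inn x (sc c y) = scA c (inn x y)) \<and>
     (\<forall>x y a. inn x (act y a) = inn x y * a) \<and>
     (\<forall>x y. st (inn x y) = inn y x) \<and>
     (\<forall>x. \<exists>b. inn x x = st b * b) \<and>
     (\<forall>x. inn x x = 0 \<longrightarrow> x = 0) \<and>
     nf_complete (hm_norm inn) UNIV"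

text \<open>A Hilbert submodule: a closed submodule (with the restricted structure it is
  again a Hilbert module).\<close>
definition hilbert_submodule ::
  "(complex \<Rightarrow> 'n::ab_group_add \<Rightarrow> 'n) \<Rightarrow> ('n \<Rightarrow> 'a \<Rightarrow> 'n) \<Rightarrow> ('n \<Rightarrow> 'n \<Rightarrow> 'a::real_normed_vector) \<Rightarrow> 'n set \<Rightarrow> bool" where
  "hilbert_submodule sc act inn M \<longleftrightarrow>
     0 \<in> M \<and>
     (\<forall>x\<in>M. \<forall>y\<in>M. x + y \<in> M) \<and>
     (\<forall>c. \<forall>x\<in>M. sc c x \<in> M) \<and>
     (\<forall>a. \<forall>x\<in>M. act x a \<in> M) \<and>
     nf_closed (hm_norm inn) M"

definition perp :: "('n \<Rightarrow> 'n \<Rightarrow> 'a::zero) \<Rightarrow> 'n set \<Rightarrow> 'n set" where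
  "perp inn S = {y. \<forall>x\<in>S. inn x y = 0}"

definition bounded_Alinear ::
  "(complex \<Rightarrow> 'n::ab_group_add \<Rightarrow> 'n) \<Rightarrow> ('n \<Rightarrow> 'a \<Rightarrow> 'n) \<Rightarrow> ('n \<Rightarrow> real) \<Rightarrow>
   (complex \<Rightarrow> 'm::ab_group_add \<Rightarrow> 'm) \<Rightarrow> ('m \<Rightarrow> 'a \<Rightarrow> 'm) \<Rightarrow> ('m \<Rightarrow> real) \<Rightarrow>
   ('n \<Rightarrow> 'm) \<Rightarrow> bool" where
  "bounded_Alinear sc1 act1 nrm1 sc2 act2 nrm2 T \<longleftrightarrow>
     (\<forall>x y. T (x + y) = T x + T y) \<and>
     (\<forall>c x. T (sc1 c x) = sc2 c (T x)) \<and>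
     (\<forall>x a. T (act1 x a) = act2 (T x) a) \<and>
     (\<exists>K. \<forall>x. nrm2 (T x) \<le> K * nrm1 x)"

end

theory Submission
  imports Defs
begin

text \<open>A faithful representation by compact operators is bounded below, so the norm of a
  compact C*-algebra may be computed up to a factor in its representation. The largest
  eigenvalue of a positive element then has its eigenprojection in the algebra, and splitting
  off such projections gives, for each \<open>x\<close> in a Hilbert module, projections \<open>e\<close> with \<open>x e\<close>
  arbitrarily close to \<open>x\<close>; if \<open>x\<close> is outside the closed submodule \<open>M\<close>, so is some \<open>x e\<close>. Since
  \<open>e\<close> has finite rank, finitely many vector functionals control the norm on \<open>N e\<close>, and the
  best approximation argument of Hilbert spaces gives \<open>m\<close> in \<open>M\<close> with \<open>x e - m\<close> orthogonal to
  \<open>M\<close> and nonzero. The same element lies in every submodule containing \<open>x\<close> and \<open>M\<close>, which for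
  the biannihilator of a kernel yields a contradiction.\<close>

section \<open>Positive semidefinite sesquilinear forms\<close>

text \<open>Testing only multiples \<open>t = s * cnj g\<close> with real \<open>s\<close> makes
  \<open>t * g\<close> real. The hypothesis becomes a real quadratic in \<open>s\<close>, and its
  minimum gives the bound.\<close>

lemma quadratic_bound:
  fixes g :: complex
  assumes pos: "\<And>t. 0 \<le> E - 2 * Re (t * g) + (cmod t)\<^sup>2 * N" and N: "0 \<le> N"
  shows "(cmod g)\<^sup>2 \<le> E * N"
proof -
  have real: "0 \<le> E - 2 * s * (cmod g)\<^sup>2 + s\<^sup>2 * (cmod g)\<^sup>2 * N" for s
  proof -
    have "cnj g * g = complex_of_real ((cmod g)\<^sup>2)"
      by (metis complex_norm_square mult.commute)
    then have "Re (complex_of_real s * cnj g * g) = s * (cmod g)\<^sup>2"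
      by (simp add: mult.assoc del: of_real_power)
    moreover have "(cmod (complex_of_real s * cnj g))\<^sup>2 = s\<^sup>2 * (cmod g)\<^sup>2"
      by (simp add: norm_mult power_mult_distrib)
    ultimately show ?thesis
      using pos[of "complex_of_real s * cnj g"] by simp
  qed
  show ?thesis
  proof (cases "N = 0")
    case True
    have "g = 0"
    proof (rule ccontr)
      assume "g \<noteq> 0"
      \<comment> \<open>With \<open>N = 0\<close> the quadratic is linear in \<open>s\<close>, and
        this value of \<open>s\<close> makes it \<open>-1\<close>.\<close>
      then show False
        using real[of "(E + 1) / (2 * (cmod g)\<^sup>2)"] True by simp
    qed
    then show ?thesis using True by simp
  next
    case False
    with N have "N > 0" by simp
    \<comment> \<open>The quadratic is smallest at \<open>s = 1 / N\<close>.\<close>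
    then show ?thesis
      using real[of "1 / N"] by (simp add: field_simps power2_eq_square)
  qed
qed

text \<open>Semidefinite on purpose: besides the Hilbert space, this covers \<open>form U\<close>
  and the forms \<open>ip v (S w)\<close> of positive operators, which may have null
  vectors.\<close>

locale semi_inner =
  fixes sc :: "complex \<Rightarrow> 'v::ab_group_add \<Rightarrow> 'v" and f :: "'v \<Rightarrow> 'v \<Rightarrow> complex"
  assumes vs: "vector_space sc"
    and add_right: "f x (y + z) = f x y + f x z"
    and scale_right: "f x (sc c y) = c * f x y"
    and cnj_sym: "f y x = cnj (f x y)"
    and nonneg: "0 \<le> Re (f x x)"
begin

abbreviation nrm :: "'v \<Rightarrow> real" where "nrm \<equiv> hnorm f"

lemma zero_right [simp]: "f x 0 = 0"
  using add_right[of x 0 0] by simp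

lemma minus_right [simp]: "f x (- y) = - f x y"
  using add_right[of x y "- y"] by (simp add: eq_neg_iff_add_eq_0 add.commute)

lemma diff_right: "f x (y - z) = f x y - f x z"
  using add_right[of x y "- z"] by simp

lemma add_left: "f (x + y) z = f x z + f y z"
  by (metis add_right cnj_sym complex_cnj_add)

lemma diff_left: "f (x - y) z = f x z - f y z"
  by (metis diff_right cnj_sym complex_cnj_diff)

lemma scale_left: "f (sc c x) y = cnj c * f x y"
  by (metis scale_right cnj_sym complex_cnj_mult)

lemma zero_left [simp]: "f 0 x = 0"
  by (metis zero_right cnj_sym complex_cnj_zero)

lemma minus_left [simp]: "f (- x) y = - f x y"
  using diff_left[of 0 x y] by simp

lemma self_real: "f x x = complex_of_real (Re (f x x))"
  using cnj_sym[of x x] by (simp add: complex_eq_iff)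

lemma nrm_sq: "(nrm x)\<^sup>2 = Re (f x x)"
  by (simp add: hnorm_def nonneg)

lemma nrm_nonneg [simp]: "0 \<le> nrm x"
  by (simp add: hnorm_def nonneg)

lemma nrm_zero [simp]: "nrm 0 = 0"
  by (simp add: hnorm_def)

lemma nrm_minus [simp]: "nrm (- x) = nrm x"
  by (simp add: hnorm_def)

lemma nrm_diff_commute: "nrm (x - y) = nrm (y - x)"
  using nrm_minus[of "x - y"] by simp

lemma nrm_scale: "nrm (sc c x) = cmod c * nrm x"
proof -
  have "f (sc c x) (sc c x) = (c * cnj c) * f x x"
    by (simp add: scale_left scale_right mult_ac)
  also have "\<dots> = complex_of_real ((cmod c)\<^sup>2 * Re (f x x))"
    by (metis self_real complex_norm_square of_real_mult)
  finally have "Re (f (sc c x) (sc c x)) = (cmod c)\<^sup>2 * Re (f x x)" by simp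
  then show ?thesis by (simp add: hnorm_def real_sqrt_mult)
qed

lemma nrm_diff_scale_sq:
  "(nrm (x - sc t z))\<^sup>2 = (nrm x)\<^sup>2 - 2 * Re (t * f x z) + (cmod t)\<^sup>2 * (nrm z)\<^sup>2"
proof -
  have "Re (f x (sc t z)) = Re (t * f x z)" "Re (f (sc t z) x) = Re (t * f x z)"
    by (simp add: scale_right) (metis cnj_sym scale_right complex_cnj complex.sel(1) cnj.simps(1))
  moreover have "(cmod t)\<^sup>2 * (nrm z)\<^sup>2 = Re (f (sc t z) (sc t z))"
    by (metis nrm_scale nrm_sq power_mult_distrib)
  ultimately show ?thesis by (simp add: nrm_sq diff_left diff_right)
qed

text \<open>If moving from \<open>x\<close> along \<open>z\<close> lowers the squared norm by at
  most \<open>E\<^sup>2\<close>, the expansion in \<open>t\<close> is a quadratic with constant term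
  \<open>E\<^sup>2\<close>.\<close>

lemma near_orthogonal:
  assumes "\<And>t. (nrm x)\<^sup>2 \<le> (nrm (x - sc t z))\<^sup>2 + E\<^sup>2" "0 \<le> E"
  shows "cmod (f x z) \<le> E * nrm z"
proof -
  have "(cmod (f x z))\<^sup>2 \<le> E\<^sup>2 * (nrm z)\<^sup>2"
  proof (rule quadratic_bound)
    show "0 \<le> E\<^sup>2 - 2 * Re (t * f x z) + (cmod t)\<^sup>2 * (nrm z)\<^sup>2" for t
      using assms(1)[of t] by (simp add: nrm_diff_scale_sq)
  qed simp
  then show ?thesis
    using assms(2) by (simp add: power_mult_distrib[symmetric])
qed

lemma Cauchy_Schwarz: "cmod (f x z) \<le> nrm x * nrm z"
  \<comment> \<open>For \<open>E = nrm x\<close> the hypothesis only says that a square is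
    nonnegative.\<close>
  by (rule near_orthogonal) auto

lemma nrm_add_sq: "(nrm (x + y))\<^sup>2 = (nrm x)\<^sup>2 + 2 * Re (f x y) + (nrm y)\<^sup>2"
  using cnj_sym[of x y] by (simp add: nrm_sq add_left add_right)

lemma nrm_diff_sq: "(nrm (x - y))\<^sup>2 = (nrm x)\<^sup>2 - 2 * Re (f x y) + (nrm y)\<^sup>2"
  using nrm_add_sq[of x "- y"] by simp

lemma nrm_triangle: "nrm (x + y) \<le> nrm x + nrm y"
proof (rule power2_le_imp_le)
  have "Re (f x y) \<le> nrm x * nrm y"
    using Cauchy_Schwarz[of x y] complex_Re_le_cmod[of "f x y"] by linarith
  then show "(nrm (x + y))\<^sup>2 \<le> (nrm x + nrm y)\<^sup>2"
    by (simp add: nrm_add_sq power2_sum)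
qed simp

lemma nrm_triangle_diff: "nrm (x - y) \<le> nrm x + nrm y"
  using nrm_triangle[of x "- y"] by simp

lemma nrm_triangle_mid: "nrm (x - z) \<le> nrm (x - y) + nrm (y - z)"
  using nrm_triangle[of "x - y" "y - z"] by simp

text \<open>A minimizer of the distance to \<open>S\<close> may fail to exist, so \<open>m\<close>
  is taken within \<open>E\<^sup>2\<close> of the infimum of the squared distances; then no
  direction in \<open>S\<close> lowers the square by more.\<close>

lemma near_projection:
  assumes S0: "0 \<in> S" and S_add: "\<And>x y. x \<in> S \<Longrightarrow> y \<in> S \<Longrightarrow> x + y \<in> S"
    and S_scale: "\<And>c x. x \<in> S \<Longrightarrow> sc c x \<in> S" and E: "0 < E"
  shows "\<exists>m\<in>S. \<forall>z\<in>S. cmod (f (x - m) z) \<le> E * nrm z"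
proof -
  let ?D = "(\<lambda>m. (nrm (x - m))\<^sup>2) ` S"
  have ne: "?D \<noteq> {}" using S0 by auto
  have bdd: "bdd_below ?D" by (rule bdd_belowI[of _ 0]) auto
  have "Inf ?D < Inf ?D + E\<^sup>2" using E by simp
  then obtain m where m: "m \<in> S" "(nrm (x - m))\<^sup>2 < Inf ?D + E\<^sup>2"
    using cInf_lessD[OF ne, of "Inf ?D + E\<^sup>2"] by blast
  have "cmod (f (x - m) z) \<le> E * nrm z" if "z \<in> S" for z
  proof (rule near_orthogonal)
    fix t
    have "Inf ?D \<le> (nrm (x - (m + sc t z)))\<^sup>2"
      by (rule cInf_lower[OF _ bdd]) (use m that S_add S_scale in blast)
    then show "(nrm (x - m))\<^sup>2 \<le> (nrm (x - m - sc t z))\<^sup>2 + E\<^sup>2"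
      using m(2) by (simp add: diff_diff_add)
  qed (use E in simp)
  then show ?thesis using m(1) by blast
qed

end

section \<open>Square roots in C*-algebras\<close>

text \<open>The solution is \<open>c = 1 - sqrt (1 - w)\<close>. The norms of the increments are dominated
  by those of the scalar iteration with \<open>w = 1\<close>, which increases and stays below 1; so the
  boundary case \<open>norm w = 1\<close> is included.\<close>

lemma sqrt_iteration:
  fixes w :: "'a::{real_normed_algebra,banach}"
  assumes w: "norm w \<le> 1"
  obtains cs c where "cs 0 = 0" "\<And>n. cs (Suc n) = (1/2) *\<^sub>R (w + cs n * cs n)"
    "cs \<longlonglongrightarrow> c" "norm c \<le> 1" "c + c = w + c * c"
proof -
  define cs where "cs = rec_nat (0::'a) (\<lambda>_ z. (1/2) *\<^sub>R (w + z * z))"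
  define p where "p = rec_nat (0::real) (\<lambda>_ z. (1 + z * z) / 2)"
  have cs0: "cs 0 = 0" and csS: "\<And>n. cs (Suc n) = (1/2) *\<^sub>R (w + cs n * cs n)"
    by (simp_all add: cs_def)
  have p0: "p 0 = 0" and pS: "\<And>n. p (Suc n) = (1 + p n * p n) / 2"
    by (simp_all add: p_def)
  have p_bounds: "0 \<le> p n \<and> p n \<le> 1" for n
  proof (induction n)
    case (Suc n)
    then have "p n * p n \<le> 1 * 1" by (intro mult_mono) auto
    then show ?case using Suc by (simp add: pS)
  qed (simp add: p0)
  have p_le: "p n \<le> p (Suc n)" for n
    using zero_le_square[of "p n - 1"] by (simp add: pS field_simps)
  have norm_cs: "norm (cs n) \<le> p n" for n
  proof (induction n)
    case (Suc n)
    have "norm (cs n * cs n) \<le> norm (cs n) * norm (cs n)" by (rule norm_mult_ineq)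
    also have "\<dots> \<le> p n * p n" using Suc by (intro mult_mono) (auto simp: p_bounds)
    finally have "norm (w + cs n * cs n) \<le> 1 + p n * p n"
      using w norm_triangle_ineq[of w "cs n * cs n"] by linarith
    then show ?case by (simp add: csS pS)
  qed (simp add: cs0 p0)
  have step: "norm (cs (Suc n) - cs n) \<le> p (Suc n) - p n" for n
  proof (induction n)
    case 0
    then show ?case using w by (simp add: csS pS cs0 p0)
  next
    case (Suc n)
    let ?x = "cs (Suc n)" and ?y = "cs n"
    \<comment> \<open>Noncommutative factorization of \<open>?x * ?x - ?y * ?y\<close>. The
      increments of \<open>p\<close> factor in the same way, so the bound carries over factor by
      factor.\<close>
    have "cs (Suc (Suc n)) - cs (Suc n) = (1/2) *\<^sub>R (?x * (?x - ?y) + (?x - ?y) * ?y)"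
      by (simp only: csS[of "Suc n"] csS[of n] scaleR_diff_right[symmetric])
         (simp add: csS[symmetric] algebra_simps)
    then have "norm (cs (Suc (Suc n)) - cs (Suc n)) = norm (?x * (?x - ?y) + (?x - ?y) * ?y) / 2"
      by simp
    also have "\<dots> \<le> (norm ?x * norm (?x - ?y) + norm (?x - ?y) * norm ?y) / 2"
      by (intro divide_right_mono norm_triangle_le add_mono norm_mult_ineq) simp
    also have "\<dots> \<le> (p (Suc n) * (p (Suc n) - p n) + (p (Suc n) - p n) * p n) / 2"
      using Suc norm_cs[of n] norm_cs[of "Suc n"] p_bounds p_le[of n]
      by (intro divide_right_mono add_mono mult_mono) auto
    also have "\<dots> = p (Suc (Suc n)) - p (Suc n)"
      by (simp add: pS[of "Suc n"]) (simp add: pS[of n] field_simps)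
    finally show ?case .
  qed
  have "incseq p" using p_le by (rule incseq_SucI)
  then obtain L where "p \<longlonglongrightarrow> L"
    using incseq_convergent[of p 1] p_bounds by metis
  \<comment> \<open>The increments of \<open>p\<close> telescope, so convergence of \<open>p\<close>
    alone makes them a summable majorant.\<close>
  then have "summable (\<lambda>n. p (Suc n) - p n)" by (rule telescope_summable)
  then have "summable (\<lambda>n. cs (Suc n) - cs n)"
    by (rule summable_comparison_test[rotated]) (use step in blast)
  then obtain c where "(\<lambda>n. \<Sum>k<n. cs (Suc k) - cs k) \<longlonglongrightarrow> c"
    using summable_LIMSEQ by blast
  then have lim: "cs \<longlonglongrightarrow> c" by (simp add: sum_lessThan_telescope cs0)
  have "(\<lambda>n. (1/2) *\<^sub>R (w + cs n * cs n)) \<longlonglongrightarrow> (1/2) *\<^sub>R (w + c * c)"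
    by (intro tendsto_intros lim)
  moreover have "(\<lambda>n. (1/2) *\<^sub>R (w + cs n * cs n)) \<longlonglongrightarrow> c"
    using LIMSEQ_Suc[OF lim] by (simp add: csS)
  ultimately have "(1/2) *\<^sub>R (w + c * c) = c" by (rule LIMSEQ_unique)
  then have "(2::real) *\<^sub>R ((1/2) *\<^sub>R (w + c * c)) = 2 *\<^sub>R c" by simp
  then have eq: "c + c = w + c * c" by (simp add: scaleR_2)
  have "norm c \<le> 1"
    using LIMSEQ_le_const2[OF tendsto_norm[OF lim]] norm_cs p_bounds by (meson order_trans)
  with cs0 csS lim eq show thesis using that by blast
qed

section \<open>C*-algebra calculus: self-adjoint square roots and a norm estimate\<close>

locale cstar =
  fixes scA :: "complex \<Rightarrow> 'a::{real_normed_algebra,banach} \<Rightarrow> 'a" and st :: "'a \<Rightarrow> 'a"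
  assumes cstar: "cstar_algebra scA st"
begin

lemma scA_vs: "vector_space scA"
  and scA_real: "scA (complex_of_real r) x = r *\<^sub>R x"
  and norm_scA: "norm (scA c x) = cmod c * norm x"
  and scA_mult_left: "scA c x * y = scA c (x * y)"
  and scA_mult_right: "x * scA c y = scA c (x * y)"
  and st_add: "st (x + y) = st x + st y"
  and st_scA: "st (scA c x) = scA (cnj c) (st x)"
  and st_mult: "st (x * y) = st y * st x"
  and st_st [simp]: "st (st x) = x"
  and cstar_id: "norm (st x * x) = (norm x)\<^sup>2"
  using cstar unfolding cstar_algebra_def by metis+

lemma scA_add: "scA c (x + y) = scA c x + scA c y"
  and scA_scA: "scA c (scA d x) = scA (c * d) x"
  and scA_diff: "scA c (x - y) = scA c x - scA c y"
  and scA_minus: "scA (- c) x = - scA c x"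
  and scA_1: "scA 1 x = x"
proof -
  interpret vector_space scA by (rule scA_vs)
  show "scA c (x + y) = scA c x + scA c y" "scA c (scA d x) = scA (c * d) x"
    "scA c (x - y) = scA c x - scA c y" "scA (- c) x = - scA c x" "scA 1 x = x"
    by (simp_all add: scale_right_distrib scale_right_diff_distrib)
qed

lemma st_zero [simp]: "st 0 = 0"
  using st_add[of 0 0] by simp

lemma st_minus: "st (- x) = - st x"
  using st_add[of x "- x"] by (simp add: eq_neg_iff_add_eq_0 add.commute)

lemma st_diff: "st (x - y) = st x - st y"
  using st_add[of x "- y"] by (simp add: st_minus)

lemma st_scaleR: "st (r *\<^sub>R x) = r *\<^sub>R st x"
  by (metis scA_real st_scA complex_cnj_complex_of_real)

lemma norm_st [simp]: "norm (st x) = norm x"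
proof -
  have le: "norm z \<le> norm (st z)" for z
  proof (cases "z = 0")
    case False
    have "norm z * norm z \<le> norm (st z) * norm z"
      using norm_mult_ineq[of "st z" z] by (simp add: cstar_id power2_eq_square)
    then show ?thesis using False by simp
  qed simp
  show ?thesis using le[of x] le[of "st x"] by simp
qed

lemma tendsto_st: "X \<longlonglongrightarrow> x \<Longrightarrow> (\<lambda>n. st (X n)) \<longlonglongrightarrow> st x"
proof -
  assume "X \<longlonglongrightarrow> x"
  then have "(\<lambda>n. norm (st (X n) - st x)) \<longlonglongrightarrow> 0"
    using tendsto_norm_zero[OF LIM_zero] by (simp flip: st_diff)
  then show ?thesis by (rule LIM_zero_cancel[OF tendsto_norm_zero_cancel])
qed

text \<open>The iterates are real polynomials in \<open>w\<close> without constant term;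
  self-adjointness and commutation with \<open>z\<close> therefore hold for them and survive the
  limit.\<close>

lemma sqrt_exists:
  assumes w: "norm w \<le> 1" "st w = w"
  obtains c where "norm c \<le> 1" "st c = c" "c + c = w + c * c"
    "\<And>z. w * z = z * w \<Longrightarrow> c * z = z * c"
proof -
  obtain cs c where cs: "cs 0 = 0" "\<And>n. cs (Suc n) = (1/2) *\<^sub>R (w + cs n * cs n)"
    "cs \<longlonglongrightarrow> c" "norm c \<le> 1" "c + c = w + c * c"
    using sqrt_iteration[OF w(1)] by metis
  have "st (cs n) = cs n" for n
    by (induction n) (simp_all add: cs(1,2) st_scaleR st_add st_mult w)
  then have "st c = c"
    using tendsto_st[OF cs(3)] LIMSEQ_unique cs(3) by simp
  moreover have "c * z = z * c" if z: "w * z = z * w" for z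
  proof -
    have "cs n * z = z * cs n" for n
    proof (induction n)
      case (Suc n)
      then have "cs n * cs n * z = z * (cs n * cs n)" by (metis mult.assoc)
      then show ?case by (simp add: cs(2) algebra_simps z)
    qed (simp add: cs)
    moreover have "(\<lambda>n. cs n * z) \<longlonglongrightarrow> c * z" "(\<lambda>n. z * cs n) \<longlonglongrightarrow> z * c"
      by (intro tendsto_intros cs(3))+
    ultimately show ?thesis by (simp add: LIMSEQ_unique)
  qed
  ultimately show thesis using cs(4,5) that by blast
qed

text \<open>With \<open>s = sqrt (1 - y\<^sup>2)\<close> the element \<open>u = y + i s\<close> of the unitization is unitary, and
  \<open>4 (y\<^sup>2 - y\<^sup>4)\<close> is the square of \<open>2 y s\<close>, the imaginary part of \<open>u\<^sup>2\<close>. The unitization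
  is avoided by letting \<open>u\<close> act on the algebra by left multiplication.\<close>

lemma norm_logistic_le_one:
  assumes y: "st y = y" "norm y \<le> 1"
  shows "norm (4 *\<^sub>R (y * y - y * y * (y * y))) \<le> 1"
proof -
  have "norm (y * y) \<le> 1 * 1"
    by (rule order_trans[OF norm_mult_ineq]) (use y in \<open>intro mult_mono; auto\<close>)
  then have "norm (y * y) \<le> 1" "st (y * y) = y * y" by (simp_all add: st_mult y(1))
  then obtain c where c: "st c = c" "c + c = y * y + c * c"
    and "\<And>z. y * y * z = z * (y * y) \<Longrightarrow> c * z = z * c"
    using sqrt_exists by metis
  then have comm: "y * c = c * y" by (metis mult.assoc)
  have yy: "y * y = c + c - c * c" using c(2) by (simp add: algebra_simps)
  have comm': "y * (c * z) = c * (y * z)" for z by (metis comm mult.assoc)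
  have yy': "y * (y * z) = c * z + c * z - c * (c * z)" for z
  proof -
    have "y * (y * z) = (c + c - c * c) * z" using yy by (metis mult.assoc)
    then show ?thesis by (simp add: algebra_simps)
  qed
  \<comment> \<open>Left multiplication by \<open>y + k s\<close>, where \<open>s = 1 - c\<close>;
    with \<open>k\<close> equal to \<open>\<i>\<close> or \<open>- \<i>\<close> these are the
    unitary and its adjoint.\<close>
  define U where "U k x = y * x + scA k (x - c * x)" for k x
  have U_norm: "norm (U k x) = norm x" if k: "k * cnj k = 1" "cnj k = - k" for k x
  proof -
    have "- (k * k) = 1" using k by simp
    then have kk: "k * k = -1" by (metis minus_minus)
    have "st (U k x) * U k x = st x * x"
      by (simp add: U_def st_add st_mult st_scA st_diff y(1) c(1) k scA_mult_left scA_mult_right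
          algebra_simps scA_add scA_diff scA_minus scA_scA kk scA_1 comm' yy')
    then have "(norm (U k x))\<^sup>2 = (norm x)\<^sup>2" by (metis cstar_id)
    then show ?thesis by simp
  qed
  \<comment> \<open>This is \<open>2 y s\<close>. The squares of the two unitaries differ by
    \<open>2 * \<i>\<close> times it, so left multiplication by \<open>q\<close> is a
    contraction.\<close>
  define q where "q = 2 *\<^sub>R (y - c * y)"
  have U_diff: "U \<i> (U \<i> x) - U (- \<i>) (U (- \<i>) x) = scA (2 * \<i>) (q * x)" for x
  proof -
    have "scA (2 * \<i>) (q * x) = scA \<i> (q * x) + scA \<i> (q * x)"
      by (metis mult_2 scA_vs vector_space_def)
    then show ?thesis
      by (simp add: U_def q_def algebra_simps scA_add scA_diff scA_minus scA_scA scA_mult_left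
          scA_mult_right scaleR_2 comm')
  qed
  have q_le: "norm (q * x) \<le> norm x" for x
  proof -
    have "norm (scA (2 * \<i>) (q * x)) \<le> norm (U \<i> (U \<i> x)) + norm (U (- \<i>) (U (- \<i>) x))"
      unfolding U_diff[symmetric] by (rule norm_triangle_ineq4)
    then show ?thesis by (simp add: U_norm norm_scA norm_mult)
  qed
  have "st q = q" by (simp add: q_def st_scaleR st_diff st_mult y(1) c(1) comm)
  then have qq: "norm (q * q) = (norm q)\<^sup>2" by (metis cstar_id)
  \<comment> \<open>Taking \<open>x = q\<close> in \<open>q_le\<close>, the C*-identity gives
    \<open>(norm q)\<^sup>2 \<le> norm q\<close>.\<close>
  have "norm q \<le> 1"
  proof (cases "q = 0")
    case False
    then show ?thesis using q_le[of q] qq by (simp add: power2_eq_square)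
  qed simp
  then have "norm (q * q) \<le> 1" using qq by (simp add: power_le_one)
  moreover have "q * q = 4 *\<^sub>R (y * y - y * y * (y * y))"
  proof -
    have "(y - c * y) * (y - c * y) = y * y - y * y * (y * y)"
      by (simp add: algebra_simps comm' yy' yy comm)
    moreover have "q * q = 4 *\<^sub>R ((y - c * y) * (y - c * y))"
      by (simp add: q_def)
    ultimately show ?thesis by metis
  qed
  ultimately show ?thesis by simp
qed

end

section \<open>Faithful representations by compact operators\<close>

locale compact_rep = cstar scA st + semi_inner hsc ip
  for scA :: "complex \<Rightarrow> 'a::{real_normed_algebra,banach} \<Rightarrow> 'a" and st :: "'a \<Rightarrow> 'a"
    and hsc :: "complex \<Rightarrow> 'h::ab_group_add \<Rightarrow> 'h" and ip :: "'h \<Rightarrow> 'h \<Rightarrow> complex" +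
  fixes rep :: "'a \<Rightarrow> 'h \<Rightarrow> 'h"
  assumes definite: "ip u u = 0 \<Longrightarrow> u = 0"
    and rep_compact: "compact_op hsc ip (rep a)"
    and rep_inj: "inj rep"
    and rep_add: "rep (a + b) u = rep a u + rep b u"
    and rep_scA: "rep (scA k a) u = hsc k (rep a u)"
    and rep_mult: "rep (a * b) u = rep a (rep b u)"
    and rep_st: "ip (rep (st a) u) v = ip u (rep a v)"
begin

lemma rep_add_right: "rep a (u + v) = rep a u + rep a v"
  and rep_scale_right: "rep a (hsc k u) = hsc k (rep a u)"
  using rep_compact[of a] by (simp_all add: compact_op_def)

lemma rep_zero_right [simp]: "rep a 0 = 0"
  using rep_add_right[of a 0 0] by simp

lemma rep_minus_right: "rep a (- u) = - rep a u"
  using rep_add_right[of a u "- u"] by (simp add: eq_neg_iff_add_eq_0 add.commute)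

lemma rep_diff_right: "rep a (u - v) = rep a u - rep a v"
  using rep_add_right[of a u "- v"] by (simp add: rep_minus_right)

lemma rep_zero [simp]: "rep 0 u = 0"
  using rep_add[of 0 0 u] by simp

lemma rep_minus: "rep (- a) u = - rep a u"
  using rep_add[of a "- a" u] by (simp add: eq_neg_iff_add_eq_0 add.commute)

lemma rep_diff: "rep (a - b) u = rep a u - rep b u"
  using rep_add[of a "- b" u] by (simp add: rep_minus)

lemma rep_scaleR: "rep (r *\<^sub>R a) u = hsc (complex_of_real r) (rep a u)"
  by (metis rep_scA scA_real)

lemma rep_eqI: "(\<And>u. rep a u = rep b u) \<Longrightarrow> a = b"
  by (rule injD[OF rep_inj]) (rule ext)

lemma nrm_eq_0: "nrm u = 0 \<Longrightarrow> u = 0"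
  by (metis definite nrm_sq of_real_0 self_real zero_power2)

lemma rep_selfadj: "st a = a \<Longrightarrow> ip (rep a u) v = ip u (rep a v)"
  using rep_st[of a u v] by simp

lemma nrm_rep_sq: "(nrm (rep a u))\<^sup>2 = Re (ip u (rep (st a * a) u))"
  using rep_st[of "st a" u "rep a u"] by (simp add: nrm_sq rep_mult)

text \<open>For \<open>norm b \<le> 1\<close> write \<open>st b * b = c + c - c * c\<close>, that
  is, \<open>1 - (1 - c)\<^sup>2\<close>. What \<open>rep b\<close> takes off the squared norm of
  \<open>u\<close> is then the squared norm of \<open>u - rep c u\<close>. The general case follows
  by scaling.\<close>

lemma rep_bounded: "nrm (rep a u) \<le> norm a * nrm u"
proof -
  have contr: "nrm (rep b u) \<le> nrm u" if "norm b \<le> 1" for b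
  proof -
    have "norm (st b * b) \<le> 1" "st (st b * b) = st b * b"
      using that by (simp_all add: cstar_id st_mult power_le_one)
    then obtain c where c: "st c = c" "c + c = st b * b + c * c"
      using sqrt_exists by metis
    then have w: "st b * b = c + c - c * c" by simp
    have "0 \<le> (nrm (u - rep c u))\<^sup>2" by simp
    also have "\<dots> = (nrm u)\<^sup>2 - (nrm (rep b u))\<^sup>2"
      using nrm_rep_sq[of c u]
      by (simp add: nrm_diff_sq nrm_rep_sq w rep_add rep_diff add_right diff_right c(1))
    finally have "(nrm (rep b u))\<^sup>2 \<le> (nrm u)\<^sup>2" by simp
    then show ?thesis by (rule power2_le_imp_le) simp
  qed
  show ?thesis
  proof (cases "a = 0")
    case False
    then have "nrm (rep ((1 / norm a) *\<^sub>R a) u) \<le> nrm u" by (intro contr) simp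
    then show ?thesis using False by (simp add: rep_scaleR nrm_scale norm_divide field_simps)
  qed simp
qed

text \<open>The element \<open>C\<close> represents \<open>1 - abs (1 - 2 y\<^sup>2)\<close>. If \<open>rep (y\<^sup>2)\<close> is at most \<open>1/2\<close>, the
  absolute value can be dropped in the image of \<open>rep\<close>, hence by injectivity also in the algebra.\<close>

lemma norm_sq_le_half:
  assumes y: "st y = y" "norm y \<le> 1" and half: "\<And>u. (nrm (rep y u))\<^sup>2 \<le> (nrm u)\<^sup>2 / 2"
  shows "(norm y)\<^sup>2 \<le> 1 / 2"
proof -
  define a where "a = y * y"
  have a: "st a = a" by (simp add: a_def st_mult y(1))
  define w where "w = 4 *\<^sub>R (a - a * a)"
  have "norm w \<le> 1" "st w = w"
    using norm_logistic_le_one[OF y] by (simp_all add: w_def a_def st_scaleR st_diff st_mult y(1))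
  then obtain C where C: "norm C \<le> 1" "st C = C" "C + C = w + C * C"
    and C_comm: "\<And>z. w * z = z * w \<Longrightarrow> C * z = z * C"
    using sqrt_exists by metis
  have "w * a = a * w" by (simp add: w_def algebra_simps)
  then have Ca: "C * a = a * C" by (rule C_comm)
  have "C = a + a"
  proof (rule rep_eqI)
    fix u
    \<comment> \<open>\<open>P\<close> and \<open>Q\<close> are \<open>1 - C\<close> and
      \<open>1 - 2 a\<close>. They commute and have equal squares, so \<open>P + Q\<close> kills
      \<open>z = (P - Q) u\<close>. As both are positive, each of their forms vanishes at
      \<open>z\<close>.\<close>
    define P where "P v = v - rep C v" for v
    define Q where "Q v = v - rep (a + a) v" for v
    define z where "z = P u - Q u"
    have P_pos: "0 \<le> Re (ip v (P v))" for v
    proof -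
      have "Re (ip v (rep C v)) \<le> nrm v * nrm (rep C v)"
        using Cauchy_Schwarz[of v "rep C v"] complex_Re_le_cmod[of "ip v (rep C v)"] by linarith
      also have "\<dots> \<le> nrm v * nrm v"
        using rep_bounded[of C v] mult_right_mono[OF C(1), of "nrm v"] by (intro mult_left_mono) auto
      also have "\<dots> = Re (ip v v)" by (simp add: nrm_sq flip: power2_eq_square)
      finally show ?thesis by (simp add: P_def diff_right)
    qed
    have Q_pos: "0 \<le> Re (ip v (Q v))" for v
      using half[of v] unfolding nrm_rep_sq by (simp add: Q_def diff_right rep_add add_right nrm_sq a_def y(1))
    have "4 *\<^sub>R (a - a * a) = (a + a) + (a + a) - (a + a) * (a + a)"
    proof -
      have "4 *\<^sub>R v = v + v + (v + v)" for v :: 'a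
        by (simp add: scaleR_2[symmetric])
      then show ?thesis by (simp add: algebra_simps)
    qed
    then have "C + C - C * C = (a + a) + (a + a) - (a + a) * (a + a)"
      using C(3) by (simp add: w_def)
    then have "(C - (a + a)) + (C - (a + a)) = C * C - (a + a) * (a + a)"
      by (simp add: algebra_simps)
    also have "\<dots> = (C - (a + a)) * C + (a + a) * (C - (a + a))"
      by (simp add: algebra_simps)
    also have "\<dots> = C * (C - (a + a)) + (a + a) * (C - (a + a))"
      using Ca by (simp add: algebra_simps)
    finally have rel: "(C - (a + a)) + (C - (a + a)) = C * (C - (a + a)) + (a + a) * (C - (a + a))" .
    have z: "z = - rep (C - (a + a)) u" by (simp add: z_def P_def Q_def rep_diff)
    have "rep ((C - (a + a)) + (C - (a + a))) u = rep (C * (C - (a + a)) + (a + a) * (C - (a + a))) u"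
      using rel by simp
    then have sum0: "P z + Q z = 0"
      unfolding P_def Q_def z
      by (simp only: rep_add[of "C - (a + a)"] rep_add[of "C * (C - (a + a))"] rep_mult rep_minus_right)
         (simp add: algebra_simps)
    have "Re (ip z (P z)) + Re (ip z (Q z)) = 0"
      using arg_cong[OF sum0, of "\<lambda>v. Re (ip z v)"] by (simp add: add_right)
    then have "Re (ip z (P z)) = 0" using P_pos[of z] Q_pos[of z] by linarith
    then have "Re (ip z (rep C z)) = (nrm z)\<^sup>2" by (simp add: P_def diff_right nrm_sq)
    moreover have "nrm (rep C z) \<le> nrm z"
      using rep_bounded[of C z] mult_right_mono[OF C(1), of "nrm z"] by simp
    then have "(nrm (rep C z))\<^sup>2 \<le> (nrm z)\<^sup>2" by (intro power_mono) auto
    \<comment> \<open>Expanding \<open>z - rep C z\<close>, the cross term is twice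
      \<open>(nrm z)\<^sup>2\<close> and the last term is at most
      \<open>(nrm z)\<^sup>2\<close>.\<close>
    ultimately have "(nrm (P z))\<^sup>2 \<le> 0" by (simp add: P_def nrm_diff_sq)
    then have "P z = 0" by (simp add: nrm_eq_0)
    then have PQ: "P z - Q z = 0" using sum0 by simp
    have "st (a + a) = a + a" by (simp add: a st_add)
    then have "ip z z = ip u (P z - Q z)"
      unfolding z_def[symmetric]
      by (subst (1) z_def) (simp add: P_def Q_def diff_left diff_right rep_selfadj C(2))
    then have "ip z z = 0" using PQ by simp
    then have "z = 0" by (rule definite)
    then show "rep C u = rep (a + a) u" by (simp add: z_def P_def Q_def)
  qed
  then have "2 * norm a \<le> 1" using C(1) by (simp flip: scaleR_2)
  then show ?thesis using cstar_id[of y] y(1) by (simp add: a_def)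
qed

text \<open>The lower bound for the representation. Normalize \<open>st b * b\<close> to
  \<open>y\<close> of norm 1; its operator norm is at most \<open>r\<^sup>2 / n\<close>. Were this
  below \<open>1/2\<close>, the previous lemma would force
  \<open>(norm y)\<^sup>2 \<le> 1/2\<close>. The factor 2 is a convenient weakening of the square
  root of 2.\<close>

lemma norm_le_of_rep_bounded:
  assumes bound: "\<And>u. nrm (rep b u) \<le> r * nrm u" and r: "0 \<le> r"
  shows "norm b \<le> 2 * r"
proof (cases "b = 0")
  case False
  define n where "n = (norm b)\<^sup>2"
  have n: "0 < n" using False by (simp add: n_def)
  define y where "y = (1 / n) *\<^sub>R (st b * b)"
  have y: "st y = y" "norm y = 1"
    using n by (simp_all add: y_def st_scaleR st_mult cstar_id) (simp add: n_def)
  have star_bound: "nrm (rep (st b) u) \<le> r * nrm u" for u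
  proof (cases "nrm (rep (st b) u) = 0")
    case nonzero: False
    have "(nrm (rep (st b) u))\<^sup>2 = Re (ip u (rep b (rep (st b) u)))"
      by (simp add: nrm_sq rep_st)
    also have "\<dots> \<le> nrm u * nrm (rep b (rep (st b) u))"
      using Cauchy_Schwarz complex_Re_le_cmod order_trans by blast
    also have "\<dots> \<le> nrm u * (r * nrm (rep (st b) u))"
      by (intro mult_left_mono bound) simp
    finally have "nrm (rep (st b) u) * nrm (rep (st b) u) \<le> (r * nrm u) * nrm (rep (st b) u)"
      by (simp add: power2_eq_square mult_ac)
    then show ?thesis using nonzero by (simp add: less_le mult_le_cancel_right)
  qed (use r in simp)
  have y_bound: "nrm (rep y u) \<le> (r\<^sup>2 / n) * nrm u" for u
  proof -
    have "nrm (rep (st b) (rep b u)) \<le> r * nrm (rep b u)" by (rule star_bound)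
    also have "\<dots> \<le> r * (r * nrm u)" by (intro mult_left_mono bound r)
    finally have "nrm (rep (st b) (rep b u)) / n \<le> r * (r * nrm u) / n"
      using n by (intro divide_right_mono) auto
    then show ?thesis
      using n by (simp add: y_def rep_scaleR rep_mult nrm_scale norm_divide power2_eq_square mult_ac)
  qed
  have "n \<le> 2 * r\<^sup>2"
  proof (rule ccontr)
    assume "\<not> n \<le> 2 * r\<^sup>2"
    then have q: "r\<^sup>2 / n \<le> 1 / 2" using n by (simp add: field_simps)
    have "(norm y)\<^sup>2 \<le> 1 / 2"
    proof (rule norm_sq_le_half)
      fix u
      have "nrm (rep y u) \<le> 1 / 2 * nrm u"
        by (rule order_trans[OF y_bound mult_right_mono[OF q nrm_nonneg]])
      then have "(nrm (rep y u))\<^sup>2 \<le> (1 / 2 * nrm u)\<^sup>2" by (intro power_mono) auto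
      then show "(nrm (rep y u))\<^sup>2 \<le> (nrm u)\<^sup>2 / 2"
        using zero_le_square[of "nrm u"] unfolding power2_eq_square by linarith
    qed (use y in auto)
    then show False using y by simp
  qed
  then have "(norm b)\<^sup>2 \<le> (2 * r)\<^sup>2"
    using zero_le_square[of r] unfolding n_def power2_eq_square by linarith
  then show ?thesis by (rule power2_le_imp_le) (use r in simp)
qed (use r in simp)

lemma norm_le_of_rep_ball:
  assumes "\<And>u. nrm u \<le> 1 \<Longrightarrow> nrm (rep b u) \<le> r" and r: "0 \<le> r"
  shows "nrm (rep b u) \<le> r * nrm u" "norm b \<le> 2 * r"
proof -
  show *: "nrm (rep b u) \<le> r * nrm u" for u
  proof (cases "nrm u = 0")
    case True
    then show ?thesis using nrm_eq_0 by force
  next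
    case False
    then have pos: "0 < nrm u" by (simp add: less_le)
    then have "nrm (rep b (hsc (complex_of_real (1 / nrm u)) u)) \<le> r"
      by (intro assms(1)) (simp add: nrm_scale norm_divide)
    then show ?thesis
      using pos by (simp add: rep_scale_right nrm_scale norm_divide field_simps)
  qed
  show "norm b \<le> 2 * r" by (rule norm_le_of_rep_bounded[OF * r])
qed

section \<open>Compactness: finite nets and projections from eigenvectors\<close>

lemma no_separated_sequence:
  fixes X :: "nat \<Rightarrow> 'h"
  assumes X: "\<And>n. nrm (X n) \<le> 1" and E: "0 < E"
    and sep: "\<And>m n. m < n \<Longrightarrow> E \<le> nrm (rep a (X n) - rep a (X m))"
  shows False
proof -
  obtain r l where r: "strict_mono r" and l: "nf_lim nrm (\<lambda>n. rep a (X (r n))) l"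
    using rep_compact[of a] X unfolding compact_op_def by blast
  then obtain K where K: "\<And>n. K \<le> n \<Longrightarrow> nrm (rep a (X (r n)) - l) < E / 2"
    using E unfolding nf_lim_def by (meson half_gt_zero)
  have "r K < r (Suc K)" using r by (simp add: strict_mono_def)
  then have "E \<le> nrm (rep a (X (r (Suc K))) - rep a (X (r K)))" by (rule sep)
  also have "\<dots> \<le> nrm (rep a (X (r (Suc K))) - l) + nrm (l - rep a (X (r K)))"
    by (rule nrm_triangle_mid)
  also have "\<dots> < E / 2 + E / 2"
    using K[of K] K[of "Suc K"] by (simp add: nrm_diff_commute[of l])
  finally show False by simp
qed

text \<open>If no finite net existed, vectors could be chosen one after another with each image at
  distance at least \<open>E\<close> from all earlier ones.\<close>

lemma finite_net:
  assumes E: "0 < E"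
  shows "\<exists>U. finite U \<and> (\<forall>u\<in>U. nrm u \<le> 1) \<and>
    (\<forall>v. nrm v \<le> 1 \<longrightarrow> (\<exists>u\<in>U. nrm (rep a v - rep a u) < E))"
proof (rule ccontr)
  assume not_thesis: "\<not> ?thesis"
  have none: "\<exists>v. nrm v \<le> 1 \<and> (\<forall>u\<in>U. E \<le> nrm (rep a v - rep a u))"
    if "finite U" "\<And>u. u \<in> U \<Longrightarrow> nrm u \<le> 1" for U
    using that not_thesis by (meson not_less)
  have "\<exists>X. \<forall>n::nat. nrm (X n) \<le> 1 \<and> (\<forall>m<n. E \<le> nrm (rep a (X n) - rep a (X m)))"
  proof (rule dependent_wellorder_choice
      [where P = "\<lambda>X n v. nrm v \<le> 1 \<and> (\<forall>m<n. E \<le> nrm (rep a v - rep a (X m)))"])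
    fix n :: nat and X :: "nat \<Rightarrow> 'h"
    assume "\<And>m. m < n \<Longrightarrow> nrm (X m) \<le> 1 \<and> (\<forall>k<m. E \<le> nrm (rep a (X m) - rep a (X k)))"
    then have "\<exists>v. nrm v \<le> 1 \<and> (\<forall>u\<in>X ` {..<n}. E \<le> nrm (rep a v - rep a u))"
      by (intro none) auto
    then show "\<exists>v. nrm v \<le> 1 \<and> (\<forall>m<n. E \<le> nrm (rep a v - rep a (X m)))" by auto
  qed auto
  then show False using no_separated_sequence[OF _ E] by metis
qed

text \<open>Instead of finite-dimensionality of the range of \<open>e\<close>, a fine net of the image of the
  unit ball suffices, since \<open>e\<close> is idempotent.\<close>

lemma projection_finite_bound:
  assumes e: "e * e = e"
  obtains U where "finite U" "\<And>d. (norm (d * e))\<^sup>2 \<le> 16 * (\<Sum>u\<in>U. (nrm (rep d u))\<^sup>2)"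
proof -
  obtain V where V: "finite V" "\<And>u. u \<in> V \<Longrightarrow> nrm u \<le> 1"
    "\<And>v. nrm v \<le> 1 \<Longrightarrow> \<exists>u\<in>V. nrm (rep e v - rep e u) < 1/4"
    using finite_net[of "1/4" e] by auto
  have "(norm (d * e))\<^sup>2 \<le> 16 * (\<Sum>u\<in>rep e ` V. (nrm (rep d u))\<^sup>2)" for d
  proof -
    define S where "S = (\<Sum>u\<in>rep e ` V. (nrm (rep d u))\<^sup>2)"
    have S0: "0 \<le> S" by (auto simp: S_def intro: sum_nonneg)
    have "nrm (rep (d * e) v) \<le> sqrt S + norm (d * e) / 4" if v: "nrm v \<le> 1" for v
    proof -
      obtain u where u: "u \<in> V" "nrm (rep e v - rep e u) < 1/4" using V(3)[OF v] by auto
      have "(nrm (rep d (rep e u)))\<^sup>2 \<le> S"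
        unfolding S_def by (rule member_le_sum) (use u V in auto)
      then have 1: "nrm (rep d (rep e u)) \<le> sqrt S" by (rule real_le_rsqrt)
      have ee: "rep e (rep e w) = rep e w" for w using e rep_mult by metis
      \<comment> \<open>Idempotence allows the error \<open>rep e v - rep e u\<close> to be hit by
        \<open>d * e\<close> instead of \<open>d\<close>, so it can be absorbed below.\<close>
      have "rep (d * e) v = rep (d * e) (rep e v - rep e u) + rep d (rep e u)"
        by (simp add: rep_diff_right rep_mult ee)
      then have "nrm (rep (d * e) v) \<le> nrm (rep (d * e) (rep e v - rep e u)) + nrm (rep d (rep e u))"
        using nrm_triangle by metis
      moreover have "nrm (rep (d * e) (rep e v - rep e u)) \<le> norm (d * e) * (1/4)"
        using u(2) by (intro order_trans[OF rep_bounded] mult_left_mono) auto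
      ultimately show ?thesis using 1 by linarith
    qed
    \<comment> \<open>The comparison factor 2 turns the net radius \<open>1/4\<close> into
      \<open>norm (d * e) / 2\<close>, which moves to the left; this yields
      \<open>4 * sqrt S\<close> and hence the constant 16.\<close>
    then have "norm (d * e) \<le> 2 * (sqrt S + norm (d * e) / 4)"
      by (rule norm_le_of_rep_ball(2)) (use S0 in auto)
    then have "norm (d * e) \<le> 4 * sqrt S" by simp
    then have "(norm (d * e))\<^sup>2 \<le> (4 * sqrt S)\<^sup>2" by (intro power_mono) auto
    then show ?thesis using S0 by (simp add: S_def power_mult_distrib)
  qed
  then show thesis using that V(1) by blast
qed

text \<open>The projection is the limit of the powers of \<open>b = a / l\<close>, where \<open>l\<close> is the operator norm
  of \<open>rep a\<close>. They converge strongly because a positive contraction \<open>S\<close> satisfies \<open>S\<^sup>2 \<le> S\<close>,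
  and compactness of \<open>rep b\<close> makes the convergence uniform on the unit ball.\<close>

lemma top_eigenprojection:
  assumes a: "st a = a" "\<And>u. 0 \<le> Re (ip u (rep a u))" "a \<noteq> 0"
  obtains l p where "0 < l" "\<And>u. nrm (rep a u) \<le> l * nrm u"
    "st p = p" "p * p = p" "p \<noteq> 0" "a * p = l *\<^sub>R p"
proof -
  define B where "B = (\<lambda>u. nrm (rep a u)) ` {u. nrm u \<le> 1}"
  define l where "l = Sup B"
  have "nrm (rep a u) \<le> norm a" if "nrm u \<le> 1" for u
    using rep_bounded[of a u] mult_left_mono[OF that, of "norm a"] by simp
  then have bdd: "bdd_above B" by (auto simp: B_def intro!: bdd_aboveI2)
  have ne: "B \<noteq> {}" by (auto simp: B_def intro: exI[of _ 0])
  have ball: "nrm (rep a u) \<le> l" if "nrm u \<le> 1" for u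
    unfolding l_def by (rule cSup_upper[OF _ bdd]) (use that in \<open>auto simp: B_def\<close>)
  have l0: "0 \<le> l" using ball[of 0] by simp
  have bound: "nrm (rep a u) \<le> l * nrm u" for u
    by (rule norm_le_of_rep_ball(1)) (use ball l0 in auto)
  have "norm a \<le> 2 * l" by (rule norm_le_of_rep_bounded[OF bound l0])
  then have l: "0 < l" using a(3) by (smt (verit) norm_le_zero_iff)
  define b where "b = (1 / l) *\<^sub>R a"
  have b_st: "st b = b" by (simp add: b_def st_scaleR a)
  have rep_b: "rep b u = hsc (complex_of_real (1 / l)) (rep a u)" for u
    by (simp only: b_def rep_scaleR)
  have b_pos: "0 \<le> Re (ip u (rep b u))" for u
    using a(2)[of u] l by (simp add: rep_b scale_right flip: of_real_divide of_real_inverse)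
  have nrm_b: "nrm (rep b u) = nrm (rep a u) / l" for u
    using l by (simp add: rep_b nrm_scale norm_divide)
  have b_contr: "nrm (rep b u) \<le> nrm u" for u
    using bound[of u] l by (simp add: nrm_b field_simps)
  \<comment> \<open>\<open>pw n\<close> is the power with exponent \<open>n + 1\<close>: the algebra need not be unital.\<close>
  define pw where "pw n = (((*) b) ^^ n) b" for n
  have pw0: "pw 0 = b" and pwS: "pw (Suc n) = b * pw n" for n by (simp_all add: pw_def)
  have pw_comm: "pw n * b = b * pw n" for n
    by (induction n) (simp_all add: pw0 pwS mult.assoc)
  have pw_mult: "pw m * pw n = pw (Suc (m + n))" for m n
    by (induction m) (simp_all add: pw0 pwS mult.assoc)
  have pw_st: "st (pw n) = pw n" for n
    by (induction n) (simp_all add: pw0 pwS st_mult b_st pw_comm)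
  have pw_contr: "nrm (rep (pw n) u) \<le> nrm u" for n u
    by (induction n) (auto simp: pw0 pwS rep_mult intro: b_contr order_trans)
  have pw_pos: "0 \<le> Re (ip u (rep (pw n) u))" for n u
  \<comment> \<open>Two steps at a time: enclosing a positive power between two factors
    \<open>b\<close> keeps it positive.\<close>
  proof (induction n arbitrary: u rule: induct_nat_012)
    case 0
    then show ?case by (simp add: pw0 b_pos)
  next
    case 1
    have "Re (ip u (rep (pw (Suc 0)) u)) = (nrm (rep b u))\<^sup>2"
      by (simp add: pw0 pwS nrm_rep_sq b_st)
    then show ?case by simp
  next
    case (ge2 n)
    have "pw (Suc (Suc n)) = b * (pw n * b)" by (simp add: pwS pw_comm)
    then have "ip u (rep (pw (Suc (Suc n))) u) = ip (rep b u) (rep (pw n) (rep b u))"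
      by (simp add: rep_mult rep_selfadj b_st)
    then show ?case using ge2(1)[of "rep b u"] by simp
  qed
  have gap: "(nrm (u - rep (pw n) u))\<^sup>2 \<le> (nrm u)\<^sup>2 - (nrm (rep (pw n) u))\<^sup>2" for n u
  proof -
    let ?S = "rep (pw n)"
    have sym: "ip (?S v) w = ip v (?S w)" for v w by (simp add: rep_selfadj pw_st)
    \<comment> \<open>Cauchy-Schwarz for this form, applied to \<open>u\<close> and
      \<open>?S u\<close>, gives \<open>S\<^sup>2 \<le> S\<close> after cancelling one factor
      \<open>nrm (?S u)\<close>.\<close>
    interpret S: semi_inner hsc "\<lambda>v w. ip v (?S w)"
    proof (rule semi_inner.intro)
      show "ip v (?S (w + z)) = ip v (?S w) + ip v (?S z)" for v w z
        by (simp add: rep_add_right add_right)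
      show "ip v (?S (hsc k w)) = k * ip v (?S w)" for k v w
        by (simp add: rep_scale_right scale_right)
      show "ip w (?S v) = cnj (ip v (?S w))" for v w
        using sym cnj_sym by metis
    qed (auto simp: vs pw_pos)
    define x where "x = nrm (?S u)"
    have "x\<^sup>2 \<le> cmod (ip u (?S (?S u)))"
      using complex_Re_le_cmod[of "ip u (?S (?S u))"] by (simp add: x_def nrm_sq flip: sym)
    also have "\<dots> \<le> sqrt (Re (ip u (?S u))) * sqrt (Re (ip (?S u) (?S (?S u))))"
      using S.Cauchy_Schwarz[of u "?S u"] by (simp add: hnorm_def)
    also have "Re (ip (?S u) (?S (?S u))) \<le> x\<^sup>2"
    proof -
      have "Re (ip (?S u) (?S (?S u))) \<le> nrm (?S u) * nrm (?S (?S u))"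
        using Cauchy_Schwarz complex_Re_le_cmod order_trans by blast
      also have "\<dots> \<le> nrm (?S u) * nrm (?S u)" by (intro mult_left_mono pw_contr) simp
      finally show ?thesis by (simp add: x_def power2_eq_square)
    qed
    finally have "x * x \<le> sqrt (Re (ip u (?S u))) * x"
      by (simp add: x_def power2_eq_square mult_left_mono pw_pos)
    then have "x \<le> sqrt (Re (ip u (?S u)))"
      by (cases "x = 0") (auto simp: x_def less_le pw_pos mult_le_cancel_right)
    then have "x\<^sup>2 \<le> (sqrt (Re (ip u (?S u))))\<^sup>2" by (intro power_mono) (auto simp: x_def)
    then have "(nrm (?S u))\<^sup>2 \<le> Re (ip u (?S u))" by (simp add: x_def pw_pos)
    then show ?thesis by (simp add: nrm_diff_sq)
  qed
  have gap': "(nrm (rep (pw n) u - rep (pw (Suc (n + k))) u))\<^sup>2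
      \<le> (nrm (rep (pw n) u))\<^sup>2 - (nrm (rep (pw (Suc (n + k))) u))\<^sup>2" for n k u
    using gap[of "rep (pw n) u" k] by (simp add: pw_mult add.commute flip: rep_mult)
  have unif: "\<exists>K. \<forall>n\<ge>K. \<forall>k u. nrm u \<le> 1 \<longrightarrow> nrm (rep (pw n) u - rep (pw (Suc (n + k))) u) \<le> E"
    if E: "0 < E" for E
  proof (rule ccontr)
    assume "\<not> ?thesis"
    then have "\<forall>K. \<exists>n k u. K \<le> n \<and> nrm u \<le> 1 \<and> E < nrm (rep (pw n) u - rep (pw (Suc (n + k))) u)"
      by (meson not_less)
    \<comment> \<open>The shift makes the index positive, so that one factor \<open>b\<close> can be
      split off and applied to the vectors first.\<close>
    then have "\<forall>K. \<exists>n k u. Suc K \<le> n \<and> nrm u \<le> 1 \<and> E < nrm (rep (pw n) u - rep (pw (Suc (n + k))) u)"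
      by blast
    then obtain N k X where N: "\<And>K. Suc K \<le> N K" and X: "\<And>K. nrm (X K) \<le> 1"
      and far: "\<And>K. E < nrm (rep (pw (N K)) (X K) - rep (pw (Suc (N K + k K))) (X K))"
      by metis
    obtain r v where r: "strict_mono r" and v: "nf_lim nrm (\<lambda>n. rep b (X (r n))) v"
      using rep_compact[of b] X unfolding compact_op_def by blast
    define g where "g n = (nrm (rep (pw n) v))\<^sup>2" for n
    have "decseq g"
      unfolding g_def by (intro decseq_SucI power_mono) (simp_all add: pwS rep_mult b_contr)
    then obtain G where "g \<longlonglongrightarrow> G"
      using decseq_convergent[of g 0] by (auto simp: g_def)
    then have "Cauchy g" by (rule LIMSEQ_imp_Cauchy)
    then obtain M where M: "\<And>m n. M \<le> m \<Longrightarrow> M \<le> n \<Longrightarrow> \<bar>g m - g n\<bar> < (E/2)\<^sup>2"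
      using E unfolding Cauchy_def dist_real_def by (meson half_gt_zero zero_less_power)
    obtain L where L: "\<And>n. L \<le> n \<Longrightarrow> nrm (rep b (X (r n)) - v) < E / 4"
      using v E unfolding nf_lim_def by (metis zero_less_divide_iff zero_less_numeral)
    define i where "i = max M L"
    obtain n where n: "N (r i) = Suc n"
      using N[of "r i"] by (metis Suc_le_D)
    have "M \<le> i" "i \<le> r i" using seq_suble[OF r] by (simp_all add: i_def)
    then have "M \<le> n" using N[of "r i"] n by simp
    define x where "x = X (r i)"
    define m where "m = Suc (n + k (r i))"
    \<comment> \<open>\<open>?D\<close> at \<open>rep b x\<close> is compared with \<open>?D\<close>
      at the limit \<open>v\<close>: the difference costs two contractions of a vector shorter than
      \<open>E / 4\<close>, and at \<open>v\<close> the decreasing squared norms are already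
      Cauchy.\<close>
    let ?D = "\<lambda>z. rep (pw n) z - rep (pw m) z"
    have "rep (pw (N (r i))) x - rep (pw (Suc (N (r i) + k (r i)))) x = ?D (rep b x)"
      by (simp add: n m_def pwS rep_mult[symmetric] pw_comm mult.assoc)
    also have "\<dots> = ?D (rep b x - v) + ?D v" by (simp add: rep_diff_right)
    finally have "E < nrm (?D (rep b x - v) + ?D v)" using far[of "r i"] by (simp add: x_def)
    also have "\<dots> \<le> nrm (?D (rep b x - v)) + nrm (?D v)" by (rule nrm_triangle)
    also have "nrm (?D (rep b x - v)) \<le> nrm (rep b x - v) + nrm (rep b x - v)"
      by (rule order_trans[OF nrm_triangle_diff]) (intro add_mono pw_contr)
    also have "nrm (rep b x - v) < E / 4" using L[of i] by (simp add: x_def i_def)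
    also have "nrm (?D v) < E / 2"
    proof (rule power2_less_imp_less)
      have "(nrm (?D v))\<^sup>2 \<le> g n - g m" using gap'[of n v "k (r i)"] by (simp add: m_def g_def)
      also have "\<dots> < (E / 2)\<^sup>2" using M[of n m] \<open>M \<le> n\<close> by (simp add: m_def)
      finally show "(nrm (?D v))\<^sup>2 < (E / 2)\<^sup>2" .
    qed (use E in simp)
    finally show False by simp
  qed
  have "Cauchy pw"
  proof (rule metric_CauchyI)
    fix E :: real assume E: "0 < E"
    then obtain K where K: "\<And>n k u. K \<le> n \<Longrightarrow> nrm u \<le> 1 \<Longrightarrow>
        nrm (rep (pw n) u - rep (pw (Suc (n + k))) u) \<le> E / 4"
      using unif[of "E / 4"] by auto
    have less: "norm (pw n - pw m) < E" if nm: "K \<le> n" "n < m" for n m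
    proof -
      obtain k where m: "m = Suc (n + k)" using nm(2) less_iff_Suc_add by auto
      have "norm (pw n - pw m) \<le> 2 * (E / 4)"
        by (rule norm_le_of_rep_ball(2)) (use K nm(1) E in \<open>auto simp: m rep_diff\<close>)
      then show ?thesis using E by simp
    qed
    have "dist (pw m) (pw n) < E" if "K \<le> m" "K \<le> n" for m n
      using less[of m n] less[of n m] that E
      by (cases m n rule: linorder_cases) (auto simp: dist_norm norm_minus_commute)
    then show "\<exists>K. \<forall>m\<ge>K. \<forall>n\<ge>K. dist (pw m) (pw n) < E" by blast
  qed
  then obtain p where p: "pw \<longlonglongrightarrow> p"
    using Cauchy_convergent convergent_def by blast
  have "st p = p" using LIMSEQ_unique[OF tendsto_st[OF p]] p by (simp add: pw_st)
  moreover have bp: "b * p = p"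
  proof (rule LIMSEQ_unique)
    show "(\<lambda>n. b * pw n) \<longlonglongrightarrow> b * p" by (intro tendsto_intros p)
    show "(\<lambda>n. b * pw n) \<longlonglongrightarrow> p" using LIMSEQ_Suc[OF p] by (simp add: pwS)
  qed
  moreover have "p * p = p"
  proof (rule LIMSEQ_unique)
    show "(\<lambda>n. pw n * p) \<longlonglongrightarrow> p * p" by (intro tendsto_intros p)
    have "pw n * p = p" for n by (induction n) (simp_all add: pw0 pwS bp mult.assoc)
    then show "(\<lambda>n. pw n * p) \<longlonglongrightarrow> p" by simp
  qed
  moreover have "a * p = l *\<^sub>R p"
  proof -
    have "l *\<^sub>R (b * p) = a * p" using l by (simp add: b_def)
    then show ?thesis by (simp add: bp)
  qed
  moreover have "p \<noteq> 0"
  proof -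
    have "1 / 4 \<le> norm (pw n)" for n
    proof -
      \<comment> \<open>For a vector \<open>u\<close> nearly attaining the norm, \<open>b\<close>
        moves \<open>u\<close> by at most \<open>h\<close>, so its power of exponent
        \<open>n + 1\<close> moves \<open>u\<close> by at most \<open>1/2\<close>. Since
        \<open>nrm u\<close> is at least \<open>3/4\<close>, a length of \<open>1/4\<close> remains,
        independently of \<open>n\<close>.\<close>
      define h where "h = 1 / (2 * (real n + 1))"
      have h: "0 < h" "h \<le> 1 / 2" "(real n + 1) * h = 1 / 2" by (simp_all add: h_def field_simps)
      then have "l * (1 - h\<^sup>2 / 2) < l" using l by simp
      then obtain u where u: "nrm u \<le> 1" "l * (1 - h\<^sup>2 / 2) < nrm (rep a u)"
        using less_cSupD[OF ne, folded l_def] by (auto simp: B_def)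
      then have big: "1 - h\<^sup>2 / 2 < nrm (rep b u)" using l by (simp add: nrm_b field_simps)
      have h2: "h\<^sup>2 \<le> (1 / 2)\<^sup>2" using h by (intro power_mono) auto
      then have "(1 - h\<^sup>2 / 2)\<^sup>2 \<le> (nrm (rep b u))\<^sup>2"
        using big by (intro power_mono) (auto simp: power_divide)
      moreover have "1 - h\<^sup>2 \<le> (1 - h\<^sup>2 / 2)\<^sup>2" by (simp add: power2_diff)
      moreover have "(nrm u)\<^sup>2 \<le> 1" using u by (simp add: power_le_one)
      ultimately have "(nrm (u - rep b u))\<^sup>2 \<le> h\<^sup>2" using gap[of u 0] unfolding pw0 by linarith
      then have near: "nrm (u - rep b u) \<le> h" by (rule power2_le_imp_le) (use h in simp)
      have "nrm (u - rep (pw m) u) \<le> (real m + 1) * h" for m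
      proof (induction m)
        case (Suc m)
        have "nrm (u - rep (pw (Suc m)) u) \<le> nrm (u - rep b u) + nrm (rep b u - rep b (rep (pw m) u))"
          unfolding pwS rep_mult by (rule nrm_triangle_mid)
        also have "nrm (rep b u - rep b (rep (pw m) u)) \<le> nrm (u - rep (pw m) u)"
          using b_contr by (simp flip: rep_diff_right)
        finally show ?case using near Suc by (simp add: algebra_simps)
      qed (simp add: pw0 near)
      then have "nrm (u - rep (pw n) u) \<le> 1 / 2" using h(3) by metis
      moreover have "nrm u \<le> nrm (u - rep (pw n) u) + nrm (rep (pw n) u)"
        using nrm_triangle[of "u - rep (pw n) u" "rep (pw n) u"] by simp
      moreover have "3 / 4 \<le> nrm u" using big b_contr[of u] h2 by (simp add: power_divide)
      moreover have "nrm (rep (pw n) u) \<le> norm (pw n)"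
        using rep_bounded[of "pw n" u] mult_left_mono[OF u(1), of "norm (pw n)"] by simp
      ultimately show ?thesis by simp
    qed
    then have "1 / 4 \<le> norm p" using LIMSEQ_le_const[OF tendsto_norm[OF p]] by blast
    then show ?thesis by auto
  qed
  ultimately show thesis using that l bound by blast
qed

text \<open>Otherwise one could keep splitting off top eigenprojections of \<open>a - a * e\<close>.
  The eigenvalues stay at least \<open>E / 2\<close>, by the comparison factor 2, and the unit
  eigenvectors have orthogonal images of that length, against compactness.\<close>

lemma approximating_projection:
  assumes a: "st a = a" "\<And>u. 0 \<le> Re (ip u (rep a u))" and E: "0 < E"
  shows "\<exists>e. st e = e \<and> e * e = e \<and> e * a = a * e \<and> norm (a - a * e) \<le> E"
proof (rule ccontr)
  assume none: "\<not> ?thesis"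
  define P where "P e \<longleftrightarrow> st e = e \<and> e * e = e \<and> e * a = a * e" for e
  \<comment> \<open>\<open>e'\<close> extends \<open>e\<close>, and \<open>v\<close> witnesses the
    new part; \<open>e' * e = e\<close> ensures that later projections still fix
    \<open>v\<close>.\<close>
  define Q where "Q e e' \<longleftrightarrow> e' * e = e \<and>
    (\<exists>v. nrm v \<le> 1 \<and> E / 2 \<le> nrm (rep a v) \<and> rep e v = 0 \<and> rep e' v = v)" for e e'
  have step: "\<exists>e'. P e' \<and> Q e e'" if "P e" for e
  proof -
    have e: "st e = e" "e * e = e" "e * a = a * e" using that by (auto simp: P_def)
    have ee: "e * (e * z) = e * z" and ea: "e * (a * z) = a * (e * z)" for z
      using e by (metis mult.assoc)+
    define a' where "a' = a - a * e"
    have big: "E < norm a'" using none e unfolding a'_def by (meson not_le)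
    have a'_st: "st a' = a'" by (simp add: a'_def st_diff st_mult a e)
    have a'_pos: "0 \<le> Re (ip u (rep a' u))" for u
    proof -
      \<comment> \<open>\<open>a'\<close> is the compression \<open>(1 - e) a (1 - e)\<close>, so
        its form at \<open>u\<close> is that of \<open>a\<close> at \<open>w\<close>.\<close>
      define w where "w = u - rep e u"
      have "rep a w - rep e (rep a w) = rep (a - a * e - e * a + e * a * e) u"
        by (simp add: w_def rep_diff rep_add rep_mult rep_diff_right algebra_simps)
      also have "\<dots> = rep a' u" by (simp add: a'_def e(3) mult.assoc e(2) ee ea)
      finally have "ip u (rep a' u) = ip u (rep a w) - ip (rep e u) (rep a w)"
        by (simp add: rep_selfadj e(1) flip: diff_right)
      then have "ip u (rep a' u) = ip w (rep a w)"
        by (simp add: w_def flip: diff_left)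
      then show ?thesis using a(2)[of w] by simp
    qed
    have "a' \<noteq> 0" using big E by auto
    then obtain l p where l: "0 < l" "\<And>u. nrm (rep a' u) \<le> l * nrm u"
      and p: "st p = p" "p * p = p" "p \<noteq> 0" "a' * p = l *\<^sub>R p"
      using top_eigenprojection[OF a'_st a'_pos] by metis
    have "norm a' \<le> 2 * l" by (rule norm_le_of_rep_bounded[OF l(2)]) (use l in simp)
    then have lE: "E / 2 \<le> l" using big by simp
    \<comment> \<open>\<open>a'\<close> is annihilated by \<open>e\<close>, and \<open>l\<close> is
      nonzero, so the new projection is orthogonal to \<open>e\<close>.\<close>
    have "l *\<^sub>R (e * p) = (e * a') * p" using p(4) by (simp add: mult.assoc)
    also have "e * a' = 0" by (simp add: a'_def algebra_simps e ee ea)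
    finally have ep: "e * p = 0" using l(1) by simp
    then have pe: "p * e = 0" by (metis e(1) p(1) st_mult st_zero)
    have ap: "a * p = l *\<^sub>R p" using p(4) ep by (simp add: a'_def left_diff_distrib mult.assoc)
    then have pa: "p * a = l *\<^sub>R p" by (metis a(1) p(1) st_mult st_scaleR)
    have P': "P (e + p)"
      by (simp add: P_def st_add distrib_left distrib_right e p ep pe ap pa)
    obtain u where u: "rep p u \<noteq> 0" using p(3) rep_eqI[of p 0] by auto
    then have nz: "nrm (rep p u) \<noteq> 0" using nrm_eq_0 by blast
    define v where "v = hsc (complex_of_real (1 / nrm (rep p u))) (rep p u)"
    have v: "nrm v = 1" using nz by (simp add: v_def nrm_scale norm_divide)
    have pv: "rep p v = v" by (simp add: v_def rep_scale_right p(2) flip: rep_mult)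
    have "rep a v = rep (a * p) v" by (simp add: rep_mult pv)
    then have "nrm (rep a v) = l" using l v pv by (simp add: ap rep_scaleR nrm_scale)
    moreover have ev: "rep e v = 0" using ep pv by (metis rep_mult rep_zero)
    moreover have "rep (e + p) v = v" by (simp add: rep_add pv ev)
    ultimately have "Q e (e + p)"
      unfolding Q_def using v lE by (auto simp: distrib_right e pe intro!: exI[of _ v])
    then show ?thesis using P' by blast
  qed
  have "P 0" by (simp add: P_def)
  then obtain F where F: "\<And>n. P (F n)" "\<And>n. Q (F n) (F (Suc n))"
    using dependent_nat_choice[of "\<lambda>_. P" "\<lambda>_. Q"] step by metis
  have F_mult: "F (Suc n) * F n = F n" for n using F(2)[of n] by (simp add: Q_def)
  obtain V where V: "\<And>n. nrm (V n) \<le> 1" "\<And>n. E / 2 \<le> nrm (rep a (V n))"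
    "\<And>n. rep (F n) (V n) = 0" "\<And>n. rep (F (Suc n)) (V n) = V n"
    using F(2) unfolding Q_def by metis
  have keep: "rep (F (Suc n + k)) (V n) = V n" for n k
  proof (induction k)
    case (Suc k)
    then show ?case using F_mult[of "Suc n + k"] by (metis add_Suc_right rep_mult)
  qed (simp add: V)
  show False
  proof (rule no_separated_sequence[OF V(1), of "E / 2" a])
    fix m n :: nat assume "m < n"
    then have Fm: "rep (F n) (V m) = V m" using keep[of m "n - Suc m"] by simp
    have Fn: "st (F n) = F n" "F n * a = a * F n" using F(1)[of n] by (auto simp: P_def)
    \<comment> \<open>\<open>F n\<close> fixes \<open>V m\<close>, kills \<open>V n\<close> and
      commutes with \<open>a\<close>; moving it across the inner product shows
      orthogonality.\<close>
    have "ip (rep a (V n)) (rep a (V m)) = ip (rep a (V n)) (rep (F n * a) (V m))"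
      by (simp add: Fn rep_mult Fm)
    also have "\<dots> = ip (rep (F n * a) (V n)) (rep a (V m))"
      by (simp add: rep_mult rep_selfadj Fn(1))
    also have "\<dots> = 0" by (simp add: Fn rep_mult V)
    finally have "(nrm (rep a (V n) - rep a (V m)))\<^sup>2 = (nrm (rep a (V n)))\<^sup>2 + (nrm (rep a (V m)))\<^sup>2"
      by (simp add: nrm_diff_sq)
    then have "(nrm (rep a (V n)))\<^sup>2 \<le> (nrm (rep a (V n) - rep a (V m)))\<^sup>2" by simp
    then have "nrm (rep a (V n)) \<le> nrm (rep a (V n) - rep a (V m))"
      by (rule power2_le_imp_le) simp
    then show "E / 2 \<le> nrm (rep a (V n) - rep a (V m))" using V(2)[of n] by simp
  qed (use E in simp)
qed

end

section \<open>Submodules of Hilbert modules\<close>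

locale hilbert_mod = compact_rep scA st hsc ip rep
  for scA :: "complex \<Rightarrow> 'a::{real_normed_algebra,banach} \<Rightarrow> 'a" and st :: "'a \<Rightarrow> 'a"
    and hsc :: "complex \<Rightarrow> 'h::ab_group_add \<Rightarrow> 'h" and ip :: "'h \<Rightarrow> 'h \<Rightarrow> complex" and rep +
  fixes sc :: "complex \<Rightarrow> 'n::ab_group_add \<Rightarrow> 'n" and act :: "'n \<Rightarrow> 'a \<Rightarrow> 'n"
    and inn :: "'n \<Rightarrow> 'n \<Rightarrow> 'a"
  assumes hilbert: "hilbert_module scA st sc act inn"
begin

lemma mod_vs: "vector_space sc"
  and act_add: "act (x + y) a = act x a + act y a"
  and inn_add: "inn x (y + z) = inn x y + inn x z"
  and inn_sc: "inn x (sc c y) = scA c (inn x y)"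
  and inn_act: "inn x (act y a) = inn x y * a"
  and st_inn: "st (inn x y) = inn y x"
  and inn_pos: "\<exists>b. inn x x = st b * b"
  and inn_definite: "inn x x = 0 \<Longrightarrow> x = 0"
  and mod_complete: "nf_complete (hm_norm inn) UNIV"
  using hilbert unfolding hilbert_module_def by simp_all

lemma act_diff: "act (x - y) a = act x a - act y a"
  using act_add[of "x - y" y a] by simp

lemma inn_diff: "inn x (y - z) = inn x y - inn x z"
  using inn_add[of x "y - z" z] by simp

lemma inn_diff_left: "inn (x - y) z = inn x z - inn y z"
  by (metis inn_diff st_diff st_inn)

lemma inn_act_left: "inn (act x a) y = st a * inn x y"
  by (metis inn_act st_inn st_mult)

lemma hm_norm_sq: "(hm_norm inn x)\<^sup>2 = norm (inn x x)"
  by (simp add: hm_norm_def)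

lemma hm_norm_nonneg [simp]: "0 \<le> hm_norm inn x"
  by (simp add: hm_norm_def)

lemma hm_norm_diff_commute: "hm_norm inn (x - y) = hm_norm inn (y - x)"
  by (simp add: hm_norm_def inn_diff inn_diff_left algebra_simps)

lemma inn_pos': 
  obtains b where "inn x x = st b * b" "norm b = hm_norm inn x"
proof -
  obtain b where b: "inn x x = st b * b" using inn_pos by blast
  then have "(norm b)\<^sup>2 = (hm_norm inn x)\<^sup>2" by (simp add: hm_norm_sq cstar_id)
  then have "norm b = hm_norm inn x" by simp
  with b show thesis using that by blast
qed

text \<open>A sum of vector functionals applied to the module inner product. It turns
  \<open>N\<close> into a scalar semi-inner product space, where best approximation arguments
  apply.\<close>

definition form :: "'h set \<Rightarrow> 'n \<Rightarrow> 'n \<Rightarrow> complex" where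
  "form U x y = (\<Sum>u\<in>U. ip u (rep (inn x y) u))"

lemma form_semi_inner: "semi_inner sc (form U)"
proof (rule semi_inner.intro)
  show "form U x (y + z) = form U x y + form U x z" for x y z
    by (simp add: form_def inn_add rep_add add_right sum.distrib)
  show "form U x (sc c y) = c * form U x y" for c x y
    by (simp add: form_def inn_sc rep_scA scale_right sum_distrib_left)
  show "form U y x = cnj (form U x y)" for x y
    unfolding form_def cnj_sum by (rule sum.cong) (metis cnj_sym rep_st st_inn)+
  show "0 \<le> Re (form U x x)" for x
  proof -
    obtain b where "inn x x = st b * b" using inn_pos by blast
    then show ?thesis by (simp add: form_def sum_nonneg flip: nrm_rep_sq)
  qed
qed (rule mod_vs)

lemma form_nrm_sq:
  assumes "inn x x = st b * b"
  shows "(hnorm (form U) x)\<^sup>2 = (\<Sum>u\<in>U. (nrm (rep b u))\<^sup>2)"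
  using semi_inner.nrm_sq[OF form_semi_inner, of U x] assms
  by (simp add: form_def nrm_rep_sq)

text \<open>Near-orthogonality for \<open>form\<close> makes the inner product itself small, since
  \<open>\<langle>x \<langle>x, y\<rangle>, y\<rangle> = \<langle>x, y\<rangle>\<^sup>* \<langle>x, y\<rangle>\<close>.\<close>

lemma sum_inn_le:
  assumes "cmod (form U y (act x (inn x y))) \<le> E * hnorm (form U) (act x (inn x y))" "0 \<le> E"
  shows "(\<Sum>u\<in>U. (nrm (rep (inn x y) u))\<^sup>2) \<le> (E * hm_norm inn x)\<^sup>2"
proof -
  define d where "d = inn x y"
  define s where "s = sqrt (\<Sum>u\<in>U. (nrm (rep d u))\<^sup>2)"
  have s: "0 \<le> s" "s\<^sup>2 = (\<Sum>u\<in>U. (nrm (rep d u))\<^sup>2)" by (simp_all add: s_def sum_nonneg)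
  have "s\<^sup>2 = Re (form U y (act x d))"
    using st_inn[of x y] by (simp add: s form_def inn_act nrm_rep_sq d_def)
  also have "\<dots> \<le> E * hnorm (form U) (act x d)"
    using assms(1) complex_Re_le_cmod order_trans unfolding d_def by blast
  also have "hnorm (form U) (act x d) \<le> hm_norm inn x * s"
  proof (rule power2_le_imp_le)
    obtain b where b: "inn x x = st b * b" "norm b = hm_norm inn x" by (rule inn_pos')
    have "inn (act x d) (act x d) = st (b * d) * (b * d)"
      by (simp add: inn_act inn_act_left b st_mult mult.assoc)
    then have "(hnorm (form U) (act x d))\<^sup>2 = (\<Sum>u\<in>U. (nrm (rep b (rep d u)))\<^sup>2)"
      by (simp add: form_nrm_sq rep_mult)
    also have "\<dots> \<le> (\<Sum>u\<in>U. (norm b * nrm (rep d u))\<^sup>2)"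
      by (intro sum_mono power_mono rep_bounded) simp
    also have "\<dots> = (hm_norm inn x * s)\<^sup>2"
      by (simp add: power_mult_distrib s b sum_distrib_left)
    finally show "(hnorm (form U) (act x d))\<^sup>2 \<le> (hm_norm inn x * s)\<^sup>2" .
  qed (simp add: s)
  finally have "s * s \<le> (E * hm_norm inn x) * s"
    using assms(2) by (simp add: power2_eq_square mult_left_mono mult.assoc)
  then have "s \<le> E * hm_norm inn x"
    using s(1) assms(2) by (cases "s = 0") (auto simp: less_le mult_le_cancel_right)
  then show ?thesis using s by (metis d_def power_mono)
qed

text \<open>Cauchy-Schwarz for the module, up to the factor 2 of the norm comparison: ordinary
  Cauchy-Schwarz for \<open>form {u}\<close> is fed into \<open>sum_inn_le\<close>, one vector
  \<open>u\<close> at a time.\<close>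

lemma norm_inn_le: "norm (inn x y) \<le> 2 * (hm_norm inn y * hm_norm inn x)"
proof (rule norm_le_of_rep_bounded)
  fix u
  interpret F: semi_inner sc "form {u}" by (rule form_semi_inner)
  obtain b where b: "inn y y = st b * b" "norm b = hm_norm inn y" by (rule inn_pos')
  have "(\<Sum>u\<in>{u}. (nrm (rep (inn x y) u))\<^sup>2) \<le> (F.nrm y * hm_norm inn x)\<^sup>2"
    by (rule sum_inn_le) (simp_all add: F.Cauchy_Schwarz)
  then have "(nrm (rep (inn x y) u))\<^sup>2 \<le> (F.nrm y * hm_norm inn x)\<^sup>2" by simp
  then have "nrm (rep (inn x y) u) \<le> F.nrm y * hm_norm inn x"
    by (rule power2_le_imp_le) simp
  moreover have "F.nrm y = nrm (rep b u)"
    using form_nrm_sq[OF b(1), of "{u}"] by simp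
  ultimately show "nrm (rep (inn x y) u) \<le> hm_norm inn y * hm_norm inn x * nrm u"
    using mult_right_mono[OF rep_bounded[of b u], of "hm_norm inn x"] by (simp add: b mult_ac)
qed simp

text \<open>Writing \<open>inn x x = st b * b\<close>, the module norm of \<open>act x e\<close> is
  \<open>norm (b * e)\<close>, to which the assumption applies with \<open>d = b\<close>.\<close>

lemma hm_norm_act_projection_le:
  assumes "\<And>d. (norm (d * e))\<^sup>2 \<le> 16 * (\<Sum>u\<in>U. (nrm (rep d u))\<^sup>2)"
  shows "hm_norm inn (act x e) \<le> 4 * hnorm (form U) x"
proof (rule power2_le_imp_le)
  obtain b where b: "inn x x = st b * b" using inn_pos by blast
  have "inn (act x e) (act x e) = st (b * e) * (b * e)"
    by (simp add: inn_act inn_act_left b st_mult mult.assoc)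
  then have "(hm_norm inn (act x e))\<^sup>2 = (norm (b * e))\<^sup>2"
    by (simp add: hm_norm_sq cstar_id)
  then show "(hm_norm inn (act x e))\<^sup>2 \<le> (4 * hnorm (form U) x)\<^sup>2"
    using assms[of b] by (simp add: power_mult_distrib form_nrm_sq[OF b])
qed (simp add: semi_inner.nrm_nonneg[OF form_semi_inner])

text \<open>As \<open>e\<close> commutes with \<open>a = inn x x\<close>, the error
  \<open>act x e - x\<close> has inner square \<open>a - a * e\<close>. The tolerance is squared
  because the module norm is a square root.\<close>

lemma act_projection_near:
  assumes "0 < E"
  shows "\<exists>e. e * e = e \<and> hm_norm inn (act x e - x) < E"
proof -
  define a where "a = inn x x"
  obtain b where b: "a = st b * b" using inn_pos a_def by blast
  have "st a = a" "0 \<le> Re (ip u (rep a u))" for u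
    by (simp_all add: b st_mult flip: nrm_rep_sq)
  then obtain e where e: "st e = e" "e * e = e" "e * a = a * e" "norm (a - a * e) \<le> (E / 2)\<^sup>2"
    using approximating_projection[of a "(E / 2)\<^sup>2"] assms by auto
  have "inn (act x e - x) (act x e - x) = e * (a * e) - e * a - a * e + a"
    by (simp add: inn_diff inn_diff_left inn_act inn_act_left e(1) a_def algebra_simps)
  also have "\<dots> = a - a * e" by (metis e(2,3) diff_self diff_0 mult.assoc uminus_add_conv_diff)
  finally have "(hm_norm inn (act x e - x))\<^sup>2 \<le> (E / 2)\<^sup>2" using e(4) by (simp add: hm_norm_sq)
  then have "hm_norm inn (act x e - x) \<le> E / 2" by (rule power2_le_imp_le) (use assms in simp)
  then show ?thesis using e(2) assms by force
qed

text \<open>For a projection \<open>e\<close> the compression \<open>M e\<close> is complete for a scalar-valued form, so the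
  orthogonal projection of \<open>x e\<close> onto \<open>M\<close> exists as in a Hilbert space.\<close>

lemma projection_compression:
  assumes M: "hilbert_submodule sc act inn M" and e: "e * e = e"
  shows "\<exists>m\<in>M. act x e - m \<in> perp inn M"
proof -
  obtain U where U: "\<And>d. (norm (d * e))\<^sup>2 \<le> 16 * (\<Sum>u\<in>U. (nrm (rep d u))\<^sup>2)"
    using projection_finite_bound[OF e] by metis
  interpret F: semi_inner sc "form U" by (rule form_semi_inner)
  have M0: "0 \<in> M" and M_add: "\<And>x y. x \<in> M \<Longrightarrow> y \<in> M \<Longrightarrow> x + y \<in> M"
    and M_sc: "\<And>c x. x \<in> M \<Longrightarrow> sc c x \<in> M" and M_act: "\<And>x a. x \<in> M \<Longrightarrow> act x a \<in> M"
    and M_closed: "nf_closed (hm_norm inn) M"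
    using M by (auto simp: hilbert_submodule_def)
  interpret V: vector_space sc by (rule mod_vs)
  have M_diff: "y - z \<in> M" if "y \<in> M" "z \<in> M" for y z
    using M_add[OF that(1) M_sc[OF that(2), of "-1"]] by simp
  define h where "h n = 1 / real (Suc n)" for n
  have h: "0 < h n" for n by (simp add: h_def)
  have h_lim: "h \<longlonglongrightarrow> 0" unfolding h_def by (rule LIMSEQ_Suc[OF lim_1_over_n])
  have "\<forall>n. \<exists>m\<in>M. \<forall>z\<in>M. cmod (form U (x - m) z) \<le> h n * F.nrm z"
    using F.near_projection[of M, OF M0 M_add M_sc h] by blast
  then obtain m where m: "\<And>n. m n \<in> M"
    and orth: "\<And>n z. z \<in> M \<Longrightarrow> cmod (form U (x - m n) z) \<le> h n * F.nrm z"
    by metis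
  have close: "F.nrm (m i - m j) \<le> h i + h j" for i j
  proof -
    \<comment> \<open>\<open>z\<close> lies in \<open>M\<close>, so both near-orthogonality
      estimates may be tested on it.\<close>
    define z where "z = m i - m j"
    have z: "z \<in> M" by (simp add: z_def m M_diff)
    have "(F.nrm z)\<^sup>2 = Re (form U (x - m j) z - form U (x - m i) z)"
      unfolding F.nrm_sq by (simp add: z_def F.diff_left)
    also have "\<dots> \<le> cmod (form U (x - m j) z) + cmod (form U (x - m i) z)"
      using complex_Re_le_cmod norm_triangle_ineq4 order_trans by blast
    also have "\<dots> \<le> h j * F.nrm z + h i * F.nrm z" by (intro add_mono orth z)
    finally have "F.nrm z * F.nrm z \<le> (h i + h j) * F.nrm z"
      by (simp add: power2_eq_square algebra_simps)
    then show ?thesis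
      using h[of i] h[of j] unfolding z_def[symmetric]
      by (cases "F.nrm z = 0") (auto simp: less_le mult_le_cancel_right)
  qed
  \<comment> \<open>The \<open>m n\<close> are Cauchy only for the seminorm of
    \<open>form U\<close>; acting by \<open>e\<close> makes them Cauchy in the module norm, at the
    cost of a factor 4.\<close>
  have "nf_cauchy (hm_norm inn) (\<lambda>n. act (m n) e)"
    unfolding nf_cauchy_def
  proof (intro allI impI)
    fix E :: real assume E: "0 < E"
    then obtain K where K: "\<And>n. K \<le> n \<Longrightarrow> h n < E / 8"
      using order_tendstoD(2)[OF h_lim, of "E / 8"] by (auto simp: eventually_sequentially)
    have "hm_norm inn (act (m i) e - act (m j) e) < E" if "K \<le> i" "K \<le> j" for i j
      using hm_norm_act_projection_le[OF U, of "m i - m j"] close[of i j] K[OF that(1)] K[OF that(2)]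
      by (simp add: act_diff)
    then show "\<exists>K. \<forall>i\<ge>K. \<forall>j\<ge>K. hm_norm inn (act (m i) e - act (m j) e) < E" by blast
  qed
  then obtain l where l: "nf_lim (hm_norm inn) (\<lambda>n. act (m n) e) l"
    using mod_complete unfolding nf_complete_def by blast
  have "\<forall>n. act (m n) e \<in> M" using m M_act by simp
  then have "l \<in> M" using M_closed l unfolding nf_closed_def by meson
  moreover have "inn z (act x e - l) = 0" if z: "z \<in> M" for z
  proof -
    have "norm (inn z (act x e - l)) < E" if E: "0 < E" for E
    proof -
      define C where "C = 2 * hm_norm inn z + 1"
      have C: "0 < C" "2 * hm_norm inn z \<le> C" by (simp_all add: C_def add_nonneg_pos)
      have EC: "0 \<le> E / (4 * C)" using E C by simp
      obtain K where K: "\<And>n. K \<le> n \<Longrightarrow> hm_norm inn (act (m n) e - l) < E / (4 * C)"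
        using l E C unfolding nf_lim_def by (metis divide_pos_pos mult_pos_pos zero_less_numeral)
      obtain K' where K': "\<And>n. K' \<le> n \<Longrightarrow> h n < E / (4 * C)"
        using order_tendstoD(2)[OF h_lim, of "E / (4 * C)"] E C by (auto simp: eventually_sequentially)
      define n where "n = max K K'"
      have "hm_norm inn (act (m n) e - l) * (2 * hm_norm inn z) \<le> E / (4 * C) * C"
        using K[of n] C(2) EC by (intro mult_mono) (auto simp: n_def)
      then have 1: "norm (inn z (act (m n) e - l)) \<le> E / 4"
        using norm_inn_le[of z "act (m n) e - l"] C by (simp add: mult_ac)
      \<comment> \<open>The test vector \<open>act z (inn z (x - m n))\<close> belongs to
        \<open>M\<close>, so near-orthogonality applies to it.\<close>
      have "(\<Sum>u\<in>U. (nrm (rep (inn z (x - m n)) u))\<^sup>2) \<le> (h n * hm_norm inn z)\<^sup>2"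
        by (rule sum_inn_le) (use orth[of _ n] M_act z h[of n] in auto)
      then have "(norm (inn z (x - m n) * e))\<^sup>2 \<le> (4 * (h n * hm_norm inn z))\<^sup>2"
        using U[of "inn z (x - m n)"] by (simp add: power_mult_distrib)
      then have "norm (inn z (x - m n) * e) \<le> 4 * (h n * hm_norm inn z)"
        by (rule power2_le_imp_le) (use h[of n] in simp)
      also have "\<dots> = 2 * (h n * (2 * hm_norm inn z))" by simp
      also have "h n * (2 * hm_norm inn z) \<le> E / (4 * C) * C"
        using K'[of n] C(2) EC by (intro mult_mono) (auto simp: n_def)
      finally have 2: "norm (inn z (x - m n) * e) \<le> E / 2" using C by simp
      have "inn z (act x e - l) = inn z (x - m n) * e + inn z (act (m n) e - l)"
        by (simp add: inn_diff inn_act left_diff_distrib)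
      then have "norm (inn z (act x e - l)) \<le> E / 2 + E / 4"
        using norm_triangle_mono[OF 2 1] by simp
      then show ?thesis using E by simp
    qed
    then show ?thesis by (metis less_irrefl zero_less_norm_iff)
  qed
  ultimately show ?thesis by (auto simp: perp_def)
qed

text \<open>If all \<open>act x e\<close> were in the closed set \<open>M\<close>, so would be their
  limit \<open>x\<close>. For an \<open>e\<close> with \<open>act x e\<close> outside
  \<open>M\<close>, the residual after projecting onto \<open>M\<close> is nonzero.\<close>

lemma not_in_submodule:
  assumes M: "hilbert_submodule sc act inn M" and x: "x \<notin> M"
  obtains e m where "m \<in> M" "act x e - m \<in> perp inn M" "act x e - m \<noteq> 0"
proof -
  have "\<exists>e. e * e = e \<and> act x e \<notin> M"
  proof (rule ccontr)
    assume "\<not> ?thesis"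
    then have in_M: "\<And>e. e * e = e \<Longrightarrow> act x e \<in> M" by blast
    have "\<forall>n. \<exists>e. e * e = e \<and> hm_norm inn (act x e - x) < 1 / real (Suc n)"
      by (intro allI act_projection_near) simp
    then obtain e where e: "\<And>n. e n * e n = e n"
      and near: "\<And>n. hm_norm inn (act x (e n) - x) < 1 / real (Suc n)" by metis
    have "nf_lim (hm_norm inn) (\<lambda>n. act x (e n)) x"
      unfolding nf_lim_def
    proof (intro allI impI)
      fix E :: real assume "0 < E"
      then obtain K where K: "1 / real (Suc K) < E" using nat_approx_posE by blast
      have "hm_norm inn (act x (e n) - x) < E" if "K \<le> n" for n
      proof -
        have "1 / real (Suc n) \<le> 1 / real (Suc K)" using that by (simp add: frac_le)
        then show ?thesis using near[of n] K by linarith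
      qed
      then show "\<exists>K. \<forall>n\<ge>K. hm_norm inn (act x (e n) - x) < E" by blast
    qed
    moreover have "\<forall>n. act x (e n) \<in> M" using in_M e by simp
    moreover have "nf_closed (hm_norm inn) M" using M by (simp add: hilbert_submodule_def)
    ultimately have "x \<in> M" unfolding nf_closed_def by meson
    then show False using x by simp
  qed
  then obtain e where e: "e * e = e" "act x e \<notin> M" by blast
  then obtain m where "m \<in> M" "act x e - m \<in> perp inn M"
    using projection_compression[OF M e(1)] by blast
  with e(2) show thesis using that by force
qed

lemma submodule_eq_UNIV:
  assumes "hilbert_submodule sc act inn M" "perp inn M = {0}"
  shows "M = UNIV"
  using not_in_submodule[OF assms(1)] assms(2) by blast

lemma perp_perp_submodule:
  assumes M: "hilbert_submodule sc act inn M"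
  shows "perp inn (perp inn M) = M"
proof
  show "M \<subseteq> perp inn (perp inn M)"
  proof
    fix x assume "x \<in> M"
    then have "st (inn x y) = 0" if "y \<in> perp inn M" for y
      using that by (simp add: perp_def)
    then show "x \<in> perp inn (perp inn M)" by (simp add: perp_def st_inn)
  qed
  then have sub: "m \<in> perp inn (perp inn M)" if "m \<in> M" for m using that by blast
  show "perp inn (perp inn M) \<subseteq> M"
  proof (rule ccontr)
    assume "\<not> ?thesis"
    then obtain x where x: "x \<in> perp inn (perp inn M)" "x \<notin> M" by blast
    obtain e m where m: "m \<in> M" "act x e - m \<in> perp inn M" "act x e - m \<noteq> 0"
      using not_in_submodule[OF M x(2)] by metis
    \<comment> \<open>The residual lies in \<open>perp inn M\<close>, while \<open>x\<close> and
      \<open>m\<close> lie in the double annihilator; so it is orthogonal to \<open>act x e\<close>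
      and to \<open>m\<close>, hence to itself.\<close>
    have "inn (act x e - m) (act x e - m) = 0"
      using m(2) x(1) sub[OF m(1)] by (simp add: perp_def inn_diff inn_act)
    then show False using inn_definite m(3) by blast
  qed
qed

end

section \<open>Kernels of bounded module maps, and the theorem\<close>

lemma kernel_submodule:
  assumes "hilbert_mod scA st hsc ip rep sc act inn" "hilbert_mod scA st hsc ip rep sc2 act2 inn2"
    and T: "bounded_Alinear sc act (hm_norm inn) sc2 act2 (hm_norm inn2) T"
  shows "hilbert_submodule sc act inn {x. T x = 0}"
proof -
  interpret N1: hilbert_mod scA st hsc ip rep sc act inn by fact
  interpret N2: hilbert_mod scA st hsc ip rep sc2 act2 inn2 by fact
  obtain K where add: "\<And>x y. T (x + y) = T x + T y" and scale: "\<And>c x. T (sc c x) = sc2 c (T x)"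
    and T_act: "\<And>x a. T (act x a) = act2 (T x) a"
    and K: "\<And>x. hm_norm inn2 (T x) \<le> K * hm_norm inn x"
    using T unfolding bounded_Alinear_def by blast
  have T0: "T 0 = 0" using add[of 0 0] by simp
  have T_diff: "T (x - y) = T x - T y" for x y using add[of "x - y" y] by simp
  have act0: "act2 0 a = 0" for a using N2.act_add[of 0 0 a] by simp
  interpret V: vector_space sc2 by (rule N2.mod_vs)
  have "nf_closed (hm_norm inn) {x. T x = 0}"
    unfolding nf_closed_def
  proof (intro allI impI, elim conjE)
    fix X l assume X: "\<forall>n. X n \<in> {x. T x = 0}" and l: "nf_lim (hm_norm inn) X l"
    have "hm_norm inn2 (T l) < E" if E: "0 < E" for E
    proof -
      \<comment> \<open>The bound \<open>K\<close> may be zero or negative;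
        \<open>\<bar>K\<bar> + 1\<close> is a positive replacement.\<close>
      obtain n where n: "hm_norm inn (X n - l) < E / (\<bar>K\<bar> + 1)"
        using l E unfolding nf_lim_def by (meson add_nonneg_pos abs_ge_zero divide_pos_pos order_refl zero_less_one)
      have "hm_norm inn2 (T l) = hm_norm inn2 (T (l - X n))" using X by (simp add: T_diff)
      also have "\<dots> \<le> K * hm_norm inn (X n - l)"
        using K[of "l - X n"] by (simp add: N1.hm_norm_diff_commute)
      also have "\<dots> \<le> (\<bar>K\<bar> + 1) * hm_norm inn (X n - l)" by (intro mult_right_mono) auto
      also have "\<dots> < E" using n by (simp add: field_simps)
      finally show ?thesis .
    qed
    then have "hm_norm inn2 (T l) \<le> 0" by (meson less_irrefl not_le)
    then have "inn2 (T l) (T l) = 0" by (simp add: hm_norm_def)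
    then show "l \<in> {x. T x = 0}" by (simp add: N2.inn_definite)
  qed
  then show ?thesis by (simp add: hilbert_submodule_def T0 add scale T_act act0)
qed

theorem theorem4p1:
  fixes scA :: "complex \<Rightarrow> 'a::{real_normed_algebra,banach} \<Rightarrow> 'a"
    and st :: "'a \<Rightarrow> 'a"
  assumes "cstar_algebra scA st"
    and "compact_cstar TYPE('h::ab_group_add) scA st"
  shows
    "(\<forall>(sc :: complex \<Rightarrow> 'n::ab_group_add \<Rightarrow> 'n) act inn M.
        hilbert_module scA st sc act inn \<and> hilbert_submodule sc act inn M \<and>
        perp inn M = {0} \<longrightarrow>
          M = UNIV \<and>
          (\<forall>f. bounded_Alinear sc act (hm_norm inn) scA (*) norm f \<and> (\<forall>x\<in>M. f x = 0)
               \<longrightarrow> f = (\<lambda>_. 0)))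
     \<and>
     (\<forall>(sc :: complex \<Rightarrow> 'p::ab_group_add \<Rightarrow> 'p) act inn
        (sc2 :: complex \<Rightarrow> 'q::ab_group_add \<Rightarrow> 'q) act2 inn2 (T :: 'p \<Rightarrow> 'q).
        hilbert_module scA st sc act inn \<and> hilbert_module scA st sc2 act2 inn2 \<and>
        bounded_Alinear sc act (hm_norm inn) sc2 act2 (hm_norm inn2) T \<longrightarrow>
          {x. T x = 0} = perp inn (perp inn {x. T x = 0}))"
proof -
  obtain hsc :: "complex \<Rightarrow> 'h \<Rightarrow> 'h" and ip rep where "hilbert_space hsc ip" "inj rep"
    "\<forall>a. compact_op hsc ip (rep a)"
    "\<forall>a b u. rep (a + b) u = rep a u + rep b u" "\<forall>c a u. rep (scA c a) u = hsc c (rep a u)"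
    "\<forall>a b u. rep (a * b) u = rep a (rep b u)" "\<forall>a u v. ip (rep (st a) u) v = ip u (rep a v)"
    using assms(2) unfolding compact_cstar_def by (elim exE conjE) (rule that)
  note rep_props = this
  have "semi_inner hsc ip"
    by (rule semi_inner.intro) (use rep_props(1)[unfolded hilbert_space_def] in blast)+
  moreover have "compact_rep_axioms scA st hsc ip rep"
  proof (rule compact_rep_axioms.intro)
    show "u = 0" if "ip u u = 0" for u
      using rep_props(1) that unfolding hilbert_space_def by blast
  qed (use rep_props(2-) in blast)+
  ultimately have rep: "compact_rep scA st hsc ip rep"
    using assms(1) by (intro compact_rep.intro cstar.intro)
  note mod = hilbert_mod.intro[OF rep hilbert_mod_axioms.intro]
  have modules: "M = UNIV \<and> (\<forall>f. bounded_Alinear sc act (hm_norm inn) scA (*) norm f \<and> (\<forall>x\<in>M. f x = 0)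
      \<longrightarrow> f = (\<lambda>_. 0))"
    if "hilbert_module scA st sc act inn" "hilbert_submodule sc act inn M" "perp inn M = {0}"
    for sc :: "complex \<Rightarrow> 'n \<Rightarrow> 'n" and act inn M
    \<comment> \<open>Once \<open>M\<close> is everything, a map vanishing on \<open>M\<close> is
      zero.\<close>
    using hilbert_mod.submodule_eq_UNIV[OF mod[OF that(1)] that(2,3)] by auto
  have kernel: "{x. T x = 0} = perp inn (perp inn {x. T x = 0})"
    if hm: "hilbert_module scA st sc act inn" "hilbert_module scA st sc2 act2 inn2"
      and T: "bounded_Alinear sc act (hm_norm inn) sc2 act2 (hm_norm inn2) T"
    for sc :: "complex \<Rightarrow> 'p \<Rightarrow> 'p" and act inn
      and sc2 :: "complex \<Rightarrow> 'q \<Rightarrow> 'q" and act2 inn2 and T :: "'p \<Rightarrow> 'q"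
  proof -
    show ?thesis
      by (rule hilbert_mod.perp_perp_submodule[OF mod[OF hm(1)], symmetric])
        (rule kernel_submodule[OF mod[OF hm(1)] mod[OF hm(2)] T])
  qed
  show ?thesis
    by (rule conjI; intro allI impI; elim conjE; rule modules kernel; assumption)
qed

end
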